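(* Let $G$ be a finite group with a unitary action on $\mathbb{C}^d$ (via a homomorphism $\rho:G\to\mathcal{U}(\mathbb{C}^d)$, $gv:=\rho(g)v$), and let $\tau\subset\mathbb{N}^2$. Then every $G$-orbit $(gv)_{g\in G}$, $v\in\mathbb{S}$, is a spherical $\tau$-design if and only if $$\tau\subset\tau_G:=\{(0,0)\}\cup\{(p,q)\in\mathbb{N}^2: H(p,q)^G=0\},$$ i.e. $\dim(H(p,q)^G)=0$ for all $(p,q)\in\tau$ with $(p,q)\neq(0,0)$.
   Context: $\mathbb{S}$ is the unit sphere of $\mathbb{C}^d$ and $\sigma$ the normalised surface area measure on $\mathbb{S}$. For $(p,q)\in\mathbb{N}^2$, $H(p,q)$ is the space of harmonic polynomials on $\mathbb{C}^d$ (annihilated by $\sum_j\partial_{z_j}\partial_{\overline{z_j}}$) homogeneous of degree $p$ in $z$ and degree $q$ in $\overline z$, regarded as functions on $\mathbb{S}$. $G$ acts on functions by $(g\cdot f)(v)=f(g^{-1}v)$ and $H(p,q)^G$ is the subspace of $G$-invariant elements. A finite sequence $X$ of points of $\mathbb{S}$ is a spherical $\tau$-design if $\frac{1}{|X|}\sum_{x\in X}f(x)=\int_{\mathbb{S}}f\,d\sigma$ for all $f\in\bigoplus_{(p,q)\in\tau}H(p,q)$. *)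

theory Defs
  imports
    "HOL-Analysis.Analysis"
    "HOL-Algebra.Group"
    "HOL-Library.Function_Algebras"
begin

text \<open>
  The surface measure is obtained from Lebesgue measure by the usual polar-coordinate (cone)
  construction: a Borel subset \<open>A\<close> of the unit sphere has normalised surface area
  \<open>vol {x. \<parallel>x\<parallel> < 1, x / \<parallel>x\<parallel> \<in> A} / vol {x. \<parallel>x\<parallel> < 1}\<close>, see \<open>emeasure_sphere_measure\<close> below.
  Since \<open>sgn 0 = 0\<close> is off the sphere, the map \<open>sgn\<close> is pushed forward to the whole space first.
\<close>

definition sphere_measure :: "'a::euclidean_space measure" where
  "sphere_measure =
     restrict_space (distr (uniform_measure lborel (ball 0 1)) borel sgn) (sphere 0 1)"

lemma measurable_sgn_uniform [measurable]:
  "(sgn :: 'a::euclidean_space \<Rightarrow> 'a) \<in> uniform_measure lborel (ball 0 1) \<rightarrow>\<^sub>M borel"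
proof -
  have "(\<lambda>x::'a. inverse (norm x) *\<^sub>R x) \<in> borel_measurable borel"
    by measurable
  then have "(sgn :: 'a \<Rightarrow> 'a) \<in> borel_measurable borel"
    by (simp add: sgn_div_norm[abs_def])
  then show ?thesis
    by (simp add: measurable_def)
qed

lemma space_sphere_measure: "space (sphere_measure :: 'a::euclidean_space measure) = sphere 0 1"
  by (simp add: sphere_measure_def space_restrict_space)

lemma sets_sphere_measure:
  "sets (sphere_measure :: 'a::euclidean_space measure) = sets (restrict_space borel (sphere 0 1))"
  by (simp add: sphere_measure_def sets_restrict_space)

lemma emeasure_sphere_measure:
  fixes A :: "'a::euclidean_space set"
  assumes "A \<in> sets borel" "A \<subseteq> sphere 0 1"
  shows "emeasure sphere_measure A =
    emeasure lborel {x \<in> ball 0 1. sgn x \<in> A} / emeasure lborel (ball (0::'a) 1)"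
proof -
  have "emeasure sphere_measure A
      = emeasure (distr (uniform_measure lborel (ball 0 1)) borel sgn) A"
    unfolding sphere_measure_def using assms by (intro emeasure_restrict_space) auto
  also have "\<dots> = emeasure (uniform_measure lborel (ball 0 1)) (sgn -` A)"
    using assms by (subst emeasure_distr) auto
  also have "\<dots> = emeasure lborel (ball 0 1 \<inter> sgn -` A) / emeasure lborel (ball (0::'a) 1)"
    using measurable_sets[OF measurable_sgn_uniform assms(1)]
    by (subst emeasure_uniform_measure) auto
  also have "ball 0 1 \<inter> sgn -` A = {x \<in> ball 0 1. sgn x \<in> A}"
    by auto
  finally show ?thesis .
qed

lemma emeasure_sphere_measure_space:
  "emeasure (sphere_measure :: 'a::euclidean_space measure) (sphere 0 1) = 1"
proof -
  have eq: "{x \<in> ball 0 1. sgn x \<in> sphere 0 1} = ball (0::'a) 1 - {0}"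
    by (auto simp: norm_sgn)
  have "emeasure lborel (ball (0::'a) 1 - {0}) = emeasure lborel (ball (0::'a) 1)"
    by (intro emeasure_Diff_null_set) auto
  moreover have "emeasure lborel (ball (0::'a) 1) \<noteq> 0"
    using unit_ball_vol_pos[of "real DIM('a)"]
    by (simp add: emeasure_ball less_imp_neq[THEN not_sym])
  moreover have "emeasure lborel (ball (0::'a) 1) < \<infinity>"
    using emeasure_lborel_ball_finite[of "0::'a" 1] by simp
  ultimately have "emeasure lborel (ball (0::'a) 1 - {0}) / emeasure lborel (ball (0::'a) 1) = 1"
    by simp
  then show ?thesis
    using emeasure_sphere_measure[of "sphere (0::'a) 1"] unfolding eq by simp
qed

definition cscale :: "complex \<Rightarrow> ('a \<Rightarrow> complex) \<Rightarrow> 'a \<Rightarrow> complex" where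
  "cscale c f = (\<lambda>v. c * f v)"

global_interpretation cfun: vector_space "cscale :: complex \<Rightarrow> ('a \<Rightarrow> complex) \<Rightarrow> 'a \<Rightarrow> complex"
  by unfold_locales (auto simp: cscale_def fun_eq_iff algebra_simps)

definition multi_indices :: "nat \<Rightarrow> ('n::finite \<Rightarrow> nat) set" where
  "multi_indices k = {\<alpha>. (\<Sum>j\<in>UNIV. \<alpha> j) = k}"

lemma finite_multi_indices: "finite (multi_indices k :: ('n::finite \<Rightarrow> nat) set)"
proof (rule finite_subset)
  show "multi_indices k \<subseteq> Pi\<^sub>E (UNIV :: 'n set) (\<lambda>_. {..k})"
    by (auto simp: multi_indices_def PiE_def intro: member_le_sum)
qed (auto intro: finite_PiE)

definition bihomogeneous_polys :: "nat \<Rightarrow> nat \<Rightarrow> (complex ^ 'n \<Rightarrow> complex) set" where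
  "bihomogeneous_polys p q =
     {f. \<exists>c. f = (\<lambda>z. \<Sum>\<alpha>\<in>multi_indices p. \<Sum>\<beta>\<in>multi_indices q.
            c \<alpha> \<beta> * (\<Prod>j\<in>UNIV. (z $ j) ^ \<alpha> j) * (\<Prod>j\<in>UNIV. cnj (z $ j) ^ \<beta> j))}"

text \<open>The Wirtinger derivatives with respect to \<open>z\<^sub>j = x\<^sub>j + \<i> y\<^sub>j\<close> and its conjugate.\<close>

definition d_z :: "'n::finite \<Rightarrow> (complex ^ 'n \<Rightarrow> complex) \<Rightarrow> complex ^ 'n \<Rightarrow> complex" where
  "d_z j f z = (frechet_derivative f (at z) (axis j 1)
                 - \<i> * frechet_derivative f (at z) (axis j \<i>)) / 2"

definition d_zbar :: "'n::finite \<Rightarrow> (complex ^ 'n \<Rightarrow> complex) \<Rightarrow> complex ^ 'n \<Rightarrow> complex" where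
  "d_zbar j f z = (frechet_derivative f (at z) (axis j 1)
                    + \<i> * frechet_derivative f (at z) (axis j \<i>)) / 2"

definition harmonic_polys :: "nat \<Rightarrow> nat \<Rightarrow> (complex ^ 'n \<Rightarrow> complex) set" where
  "harmonic_polys p q =
     {f \<in> bihomogeneous_polys p q. \<forall>z. (\<Sum>j\<in>UNIV. d_z j (d_zbar j f) z) = 0}"

text \<open>
  Functions on the unit sphere are represented by functions on the whole space that vanish off the
  sphere, so that they form a linear subspace of the space of all functions.
\<close>

definition on_sphere :: "(complex ^ 'n \<Rightarrow> complex) \<Rightarrow> complex ^ 'n \<Rightarrow> complex" where
  "on_sphere f = (\<lambda>v. if v \<in> sphere 0 1 then f v else 0)"

definition H :: "nat \<Rightarrow> nat \<Rightarrow> (complex ^ 'n \<Rightarrow> complex) set" where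
  "H p q = on_sphere ` harmonic_polys p q"

definition H_sum :: "(nat \<times> nat) set \<Rightarrow> (complex ^ 'n \<Rightarrow> complex) set" where
  "H_sum \<tau> = {\<Sum>i\<in>F. h i | F h. finite F \<and> F \<subseteq> \<tau> \<and> (\<forall>(p, q)\<in>F. h (p, q) \<in> H p q)}"

text \<open>A finite sequence of points is a family \<open>(x\<^sub>i)\<close> indexed by a finite nonempty set \<open>I\<close>;
  repeated points are counted with multiplicity.\<close>

definition spherical_design ::
  "(nat \<times> nat) set \<Rightarrow> 'i set \<Rightarrow> ('i \<Rightarrow> complex ^ 'n) \<Rightarrow> bool" where
  "spherical_design \<tau> I x \<longleftrightarrow>
     finite I \<and> I \<noteq> {} \<and> (\<forall>i\<in>I. x i \<in> sphere 0 1) \<and>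
     (\<forall>f\<in>H_sum \<tau>. (\<Sum>i\<in>I. f (x i)) / of_nat (card I) = (LINT v|sphere_measure. f v))"

definition conj_transpose :: "complex ^ 'n ^ 'm \<Rightarrow> complex ^ 'm ^ 'n" where
  "conj_transpose A = (\<chi> i j. cnj (A $ j $ i))"

definition unitary_group :: "(complex ^ 'n ^ 'n) monoid" where
  "unitary_group =
     \<lparr>carrier = {A. A ** conj_transpose A = mat 1 \<and> conj_transpose A ** A = mat 1},
      mult = (**), one = mat 1\<rparr>"

definition fun_act ::
  "('g, 'm) monoid_scheme \<Rightarrow> ('g \<Rightarrow> complex ^ 'n ^ 'n) \<Rightarrow> 'g
     \<Rightarrow> (complex ^ 'n \<Rightarrow> complex) \<Rightarrow> complex ^ 'n \<Rightarrow> complex" where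
  "fun_act G \<rho> g f = (\<lambda>v. f (\<rho> (inv\<^bsub>G\<^esub> g) *v v))"

definition H_inv ::
  "('g, 'm) monoid_scheme \<Rightarrow> ('g \<Rightarrow> complex ^ 'n ^ 'n) \<Rightarrow> nat \<Rightarrow> nat
     \<Rightarrow> (complex ^ 'n \<Rightarrow> complex) set" where
  "H_inv G \<rho> p q = {f \<in> H p q. \<forall>g\<in>carrier G. fun_act G \<rho> g f = f}"

definition tau_G ::
  "('g, 'm) monoid_scheme \<Rightarrow> ('g \<Rightarrow> complex ^ 'n ^ 'n) \<Rightarrow> (nat \<times> nat) set" where
  "tau_G G \<rho> = {(0, 0)} \<union> {(p, q). H_inv G \<rho> p q = {0}}"

end

theory Submission
  imports Defs
begin

text \<open>
  The average of \<open>f \<in> H(p,q)\<close> over a \<open>G\<close>-orbit, as a function of the base point, is the projection of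
  \<open>f\<close> onto \<open>H(p,q)\<^sup>G\<close>. So everything rests on the vanishing of \<open>\<integral> f d\<sigma>\<close> for \<open>(p,q) \<noteq> (0,0)\<close>. To prove it,
  consider the vector fields \<open>E\<^sub>j\<^sub>k = z\<^sub>j \<partial>\<^sub>k - z'\<^sub>k \<partial>'\<^sub>j\<close>, where \<open>\<partial>'\<close> denotes derivatives in the
  conjugate variables \<open>z'\<close>. They span the complexified Lie algebra of the unitary group, so rotation
  invariance of \<open>\<sigma>\<close> gives \<open>\<integral> E\<^sub>j\<^sub>k h d\<sigma> = 0\<close> for every polynomial \<open>h\<close>. By Euler's identity,
  \<open>\<Sum>\<^sub>j E\<^sub>j\<^sub>j f = (p - q) f\<close> and \<open>\<Sum>\<^sub>j\<^sub>k E\<^sub>j\<^sub>k (z'\<^sub>j \<partial>'\<^sub>k f) = |z|\<^sup>2 \<Delta>f - q (d + q - 1) f\<close>. The second identity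
  settles \<open>q > 0\<close> and the first one \<open>q = 0 < p\<close>.
\<close>

subsection \<open>Rotation invariance of the surface measure\<close>

lemma nn_integral_lborel_translate:
  fixes c :: "'a::euclidean_space"
  assumes "f \<in> borel_measurable borel"
  shows "(\<integral>\<^sup>+x. f (c + x) \<partial>lborel) = (\<integral>\<^sup>+x. f x \<partial>lborel)"
proof -
  have "(\<integral>\<^sup>+x. f x \<partial>lborel) = (\<integral>\<^sup>+x. f x \<partial>distr lborel borel ((+) c))"
    by (simp add: lborel_distr_plus)
  also have "\<dots> = (\<integral>\<^sup>+x. f (c + x) \<partial>lborel)"
    using assms by (subst nn_integral_distr) auto
  finally show ?thesis by simp
qed

lemma borel_measurable_orthogonal_transformation:
  fixes T :: "'a::euclidean_space \<Rightarrow> 'a"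
  assumes "orthogonal_transformation T"
  shows "T \<in> borel_measurable borel"
  using assms
  by (intro borel_measurable_continuous_onI linear_continuous_on)
     (simp add: linear_linear orthogonal_transformation_linear)

text \<open>Both sides, multiplied by the volume of the unit ball \<open>B\<close>, compute the measure of
  \<open>{(x, y). y \<in> B \<and> x + T y \<in> A}\<close>, sliced in the two possible ways.\<close>

lemma emeasure_lborel_orthogonal_vimage:
  fixes T :: "'a::euclidean_space \<Rightarrow> 'a"
  assumes T: "orthogonal_transformation T" and A [measurable]: "A \<in> sets borel"
  shows "emeasure lborel (T -` A) = emeasure lborel A"
proof -
  define B where "B = ball (0::'a) 1"
  note [measurable] = borel_measurable_orthogonal_transformation[OF T]
  have B [measurable]: "B \<in> sets borel" by (simp add: B_def)
  have lin: "linear T" using T by (rule orthogonal_transformation_linear)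
  obtain S where TS: "\<And>x. T (S x) = x"
    using orthogonal_transformation_surj[OF T] by (metis surjD)
  \<comment> \<open>\<open>T\<close> is an isometry and \<open>S\<close> a right inverse of it, so
    membership of \<open>y - S x\<close> in the unit ball becomes a condition that places
    \<open>x\<close> in the unit ball around \<open>T y\<close>. This is what allows slicing in the
    other direction.\<close>
  have *: "y - S x \<in> B \<longleftrightarrow> x \<in> ball (T y) 1" for x y
  proof -
    have "norm (y - S x) = norm (T (y - S x))"
      using T by (simp add: orthogonal_transformation_norm)
    also have "T (y - S x) = T y - x"
      by (simp add: linear_diff[OF lin] TS)
    finally show ?thesis by (simp add: B_def dist_norm norm_minus_commute)
  qed
  have ball_eq: "emeasure lborel (ball c 1) = emeasure lborel B" for c :: 'a
    by (simp add: B_def emeasure_ball)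
  have "emeasure lborel A * emeasure lborel B
      = (\<integral>\<^sup>+y. indicator B y * emeasure lborel A \<partial>lborel)"
    by (simp add: nn_integral_multc mult.commute)
  also have "\<dots> = (\<integral>\<^sup>+y. indicator B y * (\<integral>\<^sup>+x. indicator A (T y + x) \<partial>lborel) \<partial>lborel)"
    by (simp add: nn_integral_lborel_translate)
  also have "\<dots> = (\<integral>\<^sup>+y. \<integral>\<^sup>+x. indicator B y * indicator A (T y + x) \<partial>lborel \<partial>lborel)"
    by (simp add: nn_integral_cmult)
  also have "\<dots> = (\<integral>\<^sup>+x. \<integral>\<^sup>+y. indicator B y * indicator A (T y + x) \<partial>lborel \<partial>lborel)"
    by (rule lborel_pair.Fubini') measurable
  \<comment> \<open>For fixed \<open>x\<close>, the variable \<open>y\<close> is shifted by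
    \<open>- S x\<close>. By linearity \<open>T (- S x + y) + x = T y\<close>, so the factor with
    \<open>A\<close> no longer involves \<open>x\<close>.\<close>
  also have "\<dots> = (\<integral>\<^sup>+x. \<integral>\<^sup>+y. indicator B (- S x + y) * indicator A (T (- S x + y) + x) \<partial>lborel \<partial>lborel)"
    by (intro nn_integral_cong nn_integral_lborel_translate[symmetric]) measurable
  also have "\<dots> = (\<integral>\<^sup>+x. \<integral>\<^sup>+y. indicator (ball (T y) 1) x * indicator A (T y) \<partial>lborel \<partial>lborel)"
    by (intro nn_integral_cong)
       (simp add: linear_diff[OF lin] TS indicator_def *)
  also have "\<dots> = (\<integral>\<^sup>+y. \<integral>\<^sup>+x. indicator (ball (T y) 1) x * indicator A (T y) \<partial>lborel \<partial>lborel)"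
  proof (rule lborel_pair.Fubini')
    have "(\<lambda>(y, x). indicator (ball (T y) 1) x :: ennreal)
        = (\<lambda>z. indicator {z. dist (T (fst z)) (snd z) < 1} z)"
      by (auto simp: indicator_def)
    moreover have "(\<lambda>z. indicator {z. dist (T (fst z)) (snd z) < 1} z :: ennreal)
        \<in> borel_measurable (lborel \<Otimes>\<^sub>M lborel)"
      by measurable
    ultimately have [measurable]: "(\<lambda>(y, x). indicator (ball (T y) 1) x :: ennreal)
        \<in> borel_measurable (lborel \<Otimes>\<^sub>M lborel)"
      by simp
    show "(\<lambda>(y, x). indicator (ball (T y) 1) x * indicator A (T y) :: ennreal)
        \<in> borel_measurable (lborel \<Otimes>\<^sub>M lborel)"
      by measurable
  qed
  also have "\<dots> = (\<integral>\<^sup>+y. emeasure lborel B * indicator (T -` A) y \<partial>lborel)"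
  proof (rule nn_integral_cong)
    fix y
    have "(\<integral>\<^sup>+x. indicator (ball (T y) 1) x * indicator A (T y) \<partial>lborel)
        = emeasure lborel (ball (T y) 1) * indicator A (T y)"
      by (subst nn_integral_multc) (auto intro!: borel_measurable_indicator)
    then show "(\<integral>\<^sup>+x. indicator (ball (T y) 1) x * indicator A (T y) \<partial>lborel)
        = emeasure lborel B * indicator (T -` A) y"
      by (simp only: ball_eq) (simp add: indicator_def)
  qed
  also have "\<dots> = emeasure lborel B * emeasure lborel (T -` A)"
    using measurable_sets[OF borel_measurable_orthogonal_transformation[OF T] A]
    by (simp add: nn_integral_cmult_indicator)
  finally have "emeasure lborel A * emeasure lborel B = emeasure lborel (T -` A) * emeasure lborel B"
    by (simp add: mult.commute)
  moreover have "emeasure lborel B \<noteq> 0"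
    using unit_ball_vol_pos[of "real DIM('a)"]
    by (simp add: B_def emeasure_ball less_imp_neq[THEN not_sym])
  moreover have "emeasure lborel B \<noteq> \<infinity>"
    using emeasure_lborel_ball_finite[of "0::'a" 1] by (simp add: B_def)
  ultimately show ?thesis
    by (metis ennreal_mult_cancel_left infinity_ennreal_def mult.commute)
qed

text \<open>\<open>T\<close> preserves norms, so intersecting with the ball commutes with taking
  preimages, and Lebesgue measure is preserved.\<close>

lemma distr_uniform_ball_orthogonal:
  fixes T :: "'a::euclidean_space \<Rightarrow> 'a"
  assumes T: "orthogonal_transformation T"
  shows "distr (uniform_measure lborel (ball 0 1)) borel T = uniform_measure lborel (ball 0 1)"
proof (rule measure_eqI)
  note mT = borel_measurable_orthogonal_transformation[OF T]
  note [measurable] = mT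
  fix A assume "A \<in> sets (distr (uniform_measure lborel (ball 0 1)) borel T)"
  then have A [measurable]: "A \<in> sets borel" by simp
  have [measurable]: "T -` A \<in> sets borel" using measurable_sets[OF mT A] by simp
  have "ball 0 1 \<inter> T -` A = T -` (ball 0 1 \<inter> A)"
    using orthogonal_transformation_norm[OF T] by auto
  then have "emeasure lborel (ball 0 1 \<inter> T -` A) = emeasure lborel (ball 0 1 \<inter> A)"
    by (simp only: emeasure_lborel_orthogonal_vimage[OF T] sets.Int borel_open open_ball A)
  then show "emeasure (distr (uniform_measure lborel (ball 0 1)) borel T) A
      = emeasure (uniform_measure lborel (ball 0 1)) A"
    by (simp add: emeasure_distr)
qed simp

section \<open>Integration over the sphere\<close>

lemma integral_sphere_measure_eq:
  fixes f :: "'a::euclidean_space \<Rightarrow> 'b::{banach, second_countable_topology}"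
  assumes [measurable]: "f \<in> borel_measurable borel"
  shows "(LINT v|sphere_measure. f v)
    = (LINT x|uniform_measure lborel (ball 0 1). indicator (sphere 0 1) (sgn x) *\<^sub>R f (sgn x))"
proof -
  have [measurable]: "sphere (0::'a) 1 \<in> sets borel" by simp
  have "(\<lambda>x. indicator (sphere 0 1) x *\<^sub>R f x) \<in> borel_measurable borel"
    by measurable
  then show ?thesis
    unfolding sphere_measure_def by (simp add: integral_restrict_space integral_distr)
qed

text \<open>Radial projection commutes with \<open>T\<close>, so the invariance of the uniform
  distribution on the ball passes to its image on the sphere.\<close>

lemma integral_sphere_measure_orthogonal:
  fixes f :: "'a::euclidean_space \<Rightarrow> 'b::{banach, second_countable_topology}"
    and T :: "'a \<Rightarrow> 'a"
  assumes T: "orthogonal_transformation T" and f [measurable]: "f \<in> borel_measurable borel"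
  shows "(LINT v|sphere_measure. f (T v)) = (LINT v|sphere_measure. f v)"
proof -
  note mT = borel_measurable_orthogonal_transformation[OF T]
  note [measurable] = mT
  have lin: "linear T" using T by (rule orthogonal_transformation_linear)
  have nT: "norm (T x) = norm x" for x using orthogonal_transformation_norm[OF T] .
  have [measurable]: "sphere (0::'a) 1 \<in> sets borel" by simp
  have sgnT: "sgn (T x) = T (sgn x)" for x
    by (simp add: sgn_div_norm nT linear_cmul[OF lin])
  have "(LINT v|sphere_measure. f v)
      = (LINT x|distr (uniform_measure lborel (ball 0 1)) borel T.
           indicator (sphere 0 1) (sgn x) *\<^sub>R f (sgn x))"
    by (simp add: integral_sphere_measure_eq distr_uniform_ball_orthogonal[OF T])
  also have "\<dots> = (LINT x|uniform_measure lborel (ball 0 1).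
           indicator (sphere 0 1) (sgn (T x)) *\<^sub>R f (sgn (T x)))"
    by (subst integral_distr) auto
  also have "\<dots> = (LINT x|uniform_measure lborel (ball 0 1).
           indicator (sphere 0 1) (sgn x) *\<^sub>R f (T (sgn x)))"
    by (simp add: sgnT nT indicator_def)
  also have "\<dots> = (LINT v|sphere_measure. f (T v))"
    by (subst integral_sphere_measure_eq) auto
  finally show ?thesis by simp
qed

lemma finite_measure_sphere_measure: "finite_measure (sphere_measure :: 'a::euclidean_space measure)"
  by (rule finite_measureI) (simp add: space_sphere_measure emeasure_sphere_measure_space)

lemma borel_measurable_sphere_measure:
  "f \<in> borel_measurable borel \<Longrightarrow> f \<in> borel_measurable sphere_measure"
  using measurable_cong_sets[OF sets_sphere_measure refl] measurable_restrict_space1 by blast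

lemma integrable_sphere_measure:
  fixes f :: "'a::euclidean_space \<Rightarrow> 'b::{banach, second_countable_topology}"
  assumes "continuous_on UNIV f"
  shows "integrable sphere_measure f"
proof -
  interpret finite_measure "sphere_measure :: 'a measure" by (rule finite_measure_sphere_measure)
  have "compact (f ` sphere 0 1)"
    using assms by (intro compact_continuous_image) (auto intro: continuous_on_subset)
  then obtain B where "\<And>v. v \<in> sphere 0 1 \<Longrightarrow> norm (f v) \<le> B"
    by (meson bounded_iff compact_imp_bounded imageI)
  then show ?thesis
    using assms
    by (intro integrable_const_bound[of _ B] AE_I2 borel_measurable_sphere_measure)
       (auto simp: space_sphere_measure borel_measurable_continuous_onI)
qed

lemma integral_sphere_measure_on_sphere:
  "(LINT v|sphere_measure. on_sphere f v) = (LINT v|sphere_measure. f v)"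
  by (rule Bochner_Integration.integral_cong) (auto simp: space_sphere_measure on_sphere_def)

lemma integral_sphere_measure_const:
  "(LINT v|(sphere_measure :: 'a::euclidean_space measure). c) = (c :: complex)"
  by (simp add: space_sphere_measure measure_def emeasure_sphere_measure_space)

subsection \<open>Wirtinger derivatives\<close>

lemma wirtinger_of_has_derivative:
  assumes "(f has_derivative f') (at z)"
  shows "d_z j f z = (f' (axis j 1) - \<i> * f' (axis j \<i>)) / 2"
    and "d_zbar j f z = (f' (axis j 1) + \<i> * f' (axis j \<i>)) / 2"
  using frechet_derivative_at[OF assms] by (simp_all add: d_z_def d_zbar_def)

text \<open>A real-linear map is determined by its values on \<open>axis j 1\<close> and
  \<open>axis j \<i>\<close>. Regrouping these values gives the familiar splitting of
  \<open>df\<close> into its \<open>dz\<close> part and its \<open>dz'\<close> part, with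
  \<open>z'\<close> the conjugate variable.\<close>

lemma frechet_derivative_wirtinger:
  fixes f :: "complex ^ 'n \<Rightarrow> complex"
  assumes "f differentiable (at z)"
  shows "frechet_derivative f (at z) h
    = (\<Sum>j\<in>UNIV. d_z j f z * h $ j + d_zbar j f z * cnj (h $ j))"
proof -
  define L where "L = frechet_derivative f (at z)"
  have lin: "linear L" unfolding L_def by (rule linear_frechet_derivative[OF assms])
  have "h = (\<Sum>j\<in>UNIV. Re (h $ j) *\<^sub>R axis j 1 + Im (h $ j) *\<^sub>R axis j \<i>)"
    by (simp add: vec_eq_iff axis_def if_distrib if_distribR sum.distrib complex_eq_iff cong: if_cong)
  then have "L h = L (\<Sum>j\<in>UNIV. Re (h $ j) *\<^sub>R axis j 1 + Im (h $ j) *\<^sub>R axis j \<i>)"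
    by simp
  also have "\<dots> = (\<Sum>j\<in>UNIV. Re (h $ j) *\<^sub>R L (axis j 1) + Im (h $ j) *\<^sub>R L (axis j \<i>))"
    by (simp add: linear_sum[OF lin] linear_add[OF lin] linear_cmul[OF lin])
  also have "\<dots> = (\<Sum>j\<in>UNIV. d_z j f z * h $ j + d_zbar j f z * cnj (h $ j))"
  proof (intro sum.cong refl)
    fix j
    have *: "x * a + y * b = (a - \<i> * b) / 2 * (x + \<i> * y) + (a + \<i> * b) / 2 * (x - \<i> * y)"
      for a b x y :: complex
      by (simp add: field_simps)
    have "h $ j = of_real (Re (h $ j)) + \<i> * of_real (Im (h $ j))" by (rule complex_eq)
    moreover have "cnj (h $ j) = of_real (Re (h $ j)) - \<i> * of_real (Im (h $ j))"
      by (simp add: complex_eq_iff)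
    ultimately show "Re (h $ j) *\<^sub>R L (axis j 1) + Im (h $ j) *\<^sub>R L (axis j \<i>)
        = d_z j f z * h $ j + d_zbar j f z * cnj (h $ j)"
      unfolding d_z_def d_zbar_def L_def[symmetric] scaleR_conv_of_real using * by metis
  qed
  finally show ?thesis by (simp add: L_def)
qed

lemma has_derivative_wirtinger:
  fixes f :: "complex ^ 'n \<Rightarrow> complex"
  assumes "f differentiable (at z)"
  shows "(f has_derivative (\<lambda>h. \<Sum>j\<in>UNIV. d_z j f z * h $ j + d_zbar j f z * cnj (h $ j))) (at z)"
proof -
  have "frechet_derivative f (at z)
      = (\<lambda>h. \<Sum>j\<in>UNIV. d_z j f z * h $ j + d_zbar j f z * cnj (h $ j))"
    using frechet_derivative_wirtinger[OF assms] by blast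
  then show ?thesis
    using assms by (simp add: frechet_derivative_works)
qed

lemma has_derivative_coord: "((\<lambda>z::complex ^ 'n. z $ k) has_derivative (\<lambda>h. h $ k)) (at z)"
  by (rule bounded_linear_imp_has_derivative[OF bounded_linear_vec_nth])

lemma has_derivative_cnj_coord:
  "((\<lambda>z::complex ^ 'n. cnj (z $ k)) has_derivative (\<lambda>h. cnj (h $ k))) (at z)"
  by (rule bounded_linear_imp_has_derivative
      [OF bounded_linear_compose[OF bounded_linear_cnj bounded_linear_vec_nth]])

lemma differentiable_coord [simp]:
  "(\<lambda>z::complex ^ 'n. z $ k) differentiable (at z)"
  "(\<lambda>z::complex ^ 'n. cnj (z $ k)) differentiable (at z)"
  using has_derivative_coord has_derivative_cnj_coord unfolding differentiable_def by blast+

lemma wirtinger_coord [simp]: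
  "d_z j (\<lambda>z. z $ k) z = (if j = k then 1 else 0)"
  "d_zbar j (\<lambda>z. z $ k) z = 0"
  "d_z j (\<lambda>z. cnj (z $ k)) z = 0"
  "d_zbar j (\<lambda>z. cnj (z $ k)) z = (if j = k then 1 else 0)"
  by (auto simp: wirtinger_of_has_derivative[OF has_derivative_coord]
        wirtinger_of_has_derivative[OF has_derivative_cnj_coord] axis_def)

lemma wirtinger_const [simp]: "d_z j (\<lambda>z. c) z = 0" "d_zbar j (\<lambda>z. c) z = 0"
  by (simp_all add: wirtinger_of_has_derivative[OF has_derivative_const])

lemma wirtinger_add:
  assumes "f differentiable (at z)" "g differentiable (at z)"
  shows "d_z j (\<lambda>z. f z + g z) z = d_z j f z + d_z j g z"
    and "d_zbar j (\<lambda>z. f z + g z) z = d_zbar j f z + d_zbar j g z"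
proof -
  note D = has_derivative_add[OF assms[unfolded frechet_derivative_works]]
  show "d_z j (\<lambda>z. f z + g z) z = d_z j f z + d_z j g z"
    by (subst wirtinger_of_has_derivative[OF D]) (simp add: d_z_def field_simps)
  show "d_zbar j (\<lambda>z. f z + g z) z = d_zbar j f z + d_zbar j g z"
    by (subst wirtinger_of_has_derivative[OF D]) (simp add: d_zbar_def field_simps)
qed

lemma wirtinger_mult:
  assumes "f differentiable (at z)" "g differentiable (at z)"
  shows "d_z j (\<lambda>z. f z * g z) z = d_z j f z * g z + f z * d_z j g z"
    and "d_zbar j (\<lambda>z. f z * g z) z = d_zbar j f z * g z + f z * d_zbar j g z"
proof -
  note D = has_derivative_mult[OF assms[unfolded frechet_derivative_works]]
  show "d_z j (\<lambda>z. f z * g z) z = d_z j f z * g z + f z * d_z j g z"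
    by (subst wirtinger_of_has_derivative[OF D]) (simp add: d_z_def field_simps)
  show "d_zbar j (\<lambda>z. f z * g z) z = d_zbar j f z * g z + f z * d_zbar j g z"
    by (subst wirtinger_of_has_derivative[OF D]) (simp add: d_zbar_def field_simps)
qed

lemma wirtinger_cmult:
  assumes "f differentiable (at z)"
  shows "d_z j (\<lambda>z. c * f z) z = c * d_z j f z"
    and "d_zbar j (\<lambda>z. c * f z) z = c * d_zbar j f z"
  using wirtinger_mult[OF differentiable_const assms] by simp_all

lemma wirtinger_sum:
  assumes "\<And>i. i \<in> I \<Longrightarrow> f i differentiable (at z)"
  shows "d_z j (\<lambda>z. \<Sum>i\<in>I. f i z) z = (\<Sum>i\<in>I. d_z j (f i) z)"
    and "d_zbar j (\<lambda>z. \<Sum>i\<in>I. f i z) z = (\<Sum>i\<in>I. d_zbar j (f i) z)"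
proof -
  have "(f i has_derivative frechet_derivative (f i) (at z)) (at z)" if "i \<in> I" for i
    using assms[OF that] by (simp add: frechet_derivative_works)
  then have D: "((\<lambda>z. \<Sum>i\<in>I. f i z) has_derivative
      (\<lambda>h. \<Sum>i\<in>I. frechet_derivative (f i) (at z) h)) (at z)"
    by (rule has_derivative_sum)
  show "d_z j (\<lambda>z. \<Sum>i\<in>I. f i z) z = (\<Sum>i\<in>I. d_z j (f i) z)"
    by (subst wirtinger_of_has_derivative[OF D])
       (simp add: d_z_def sum_divide_distrib[symmetric] sum_subtractf sum_distrib_left)
  show "d_zbar j (\<lambda>z. \<Sum>i\<in>I. f i z) z = (\<Sum>i\<in>I. d_zbar j (f i) z)"
    by (subst wirtinger_of_has_derivative[OF D])
       (simp add: d_zbar_def sum_divide_distrib[symmetric] sum.distrib sum_distrib_left)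
qed

lemma linear_matrix_vector_mult_complex:
  "linear (\<lambda>z. (U :: complex ^ 'n ^ 'm) *v z)"
  by (rule linearI)
     (simp_all add: vec_eq_iff matrix_vector_mult_def algebra_simps sum.distrib scaleR_sum_right)

lemma has_derivative_matrix_vector_mult:
  "((\<lambda>z. (U :: complex ^ 'n ^ 'm) *v z) has_derivative (\<lambda>h. U *v h)) (at z)"
  by (rule bounded_linear_imp_has_derivative)
     (simp add: linear_conv_bounded_linear[symmetric] linear_matrix_vector_mult_complex)

lemma matrix_vector_mult_axis:
  "((U :: complex ^ 'n ^ 'm) *v axis j x) $ k = U $ k $ j * x"
  by (simp add: matrix_vector_mult_def axis_def if_distrib cong: if_cong)

lemma differentiable_compose_matrix:
  fixes f :: "complex ^ 'n \<Rightarrow> complex"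
  assumes "f differentiable (at (U *v z))"
  shows "(\<lambda>z. f (U *v z)) differentiable (at z)"
  using differentiable_chain_at[of "\<lambda>z. U *v z" z f] assms has_derivative_matrix_vector_mult[of U z]
  by (auto simp: differentiable_def o_def)

text \<open>Multiplication by \<open>U\<close> is complex linear, so the two kinds of Wirtinger
  derivatives do not mix in the chain rule; the conjugate ones pick up conjugated entries.\<close>

lemma wirtinger_compose_matrix:
  fixes f :: "complex ^ 'n \<Rightarrow> complex"
  assumes "f differentiable (at (U *v z))"
  shows "d_z j (\<lambda>z. f (U *v z)) z = (\<Sum>k\<in>UNIV. U $ k $ j * d_z k f (U *v z))"
    and "d_zbar j (\<lambda>z. f (U *v z)) z = (\<Sum>k\<in>UNIV. cnj (U $ k $ j) * d_zbar k f (U *v z))"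
proof -
  let ?L = "frechet_derivative f (at (U *v z))"
  have D: "((\<lambda>z. f (U *v z)) has_derivative (\<lambda>h. ?L (U *v h))) (at z)"
    using assms by (intro has_derivative_compose[OF has_derivative_matrix_vector_mult])
      (simp add: frechet_derivative_works)
  show "d_z j (\<lambda>z. f (U *v z)) z = (\<Sum>k\<in>UNIV. U $ k $ j * d_z k f (U *v z))"
    by (subst wirtinger_of_has_derivative[OF D])
       (simp add: frechet_derivative_wirtinger[OF assms] matrix_vector_mult_axis
          sum_distrib_left sum_subtractf[symmetric] sum_divide_distrib algebra_simps)
  show "d_zbar j (\<lambda>z. f (U *v z)) z = (\<Sum>k\<in>UNIV. cnj (U $ k $ j) * d_zbar k f (U *v z))"
    by (subst wirtinger_of_has_derivative[OF D])
       (simp add: frechet_derivative_wirtinger[OF assms] matrix_vector_mult_axis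
          sum_distrib_left sum.distrib[symmetric] sum_divide_distrib algebra_simps)
qed

subsection \<open>Bihomogeneous polynomials\<close>

text \<open>A description of the bihomogeneous polynomials by closure rules, so that facts about
  them follow by induction with the product rule instead of by computing with coefficient arrays.
  Agreement with the definition by coefficients is
  \<open>bihomogeneous_polys_iff_bihom\<close>.\<close>

inductive bihom :: "nat \<Rightarrow> nat \<Rightarrow> (complex ^ 'n \<Rightarrow> complex) \<Rightarrow> bool" where
  bihom_zero: "bihom p q (\<lambda>z. 0)"
| bihom_one: "bihom 0 0 (\<lambda>z. 1)"
| bihom_cmult: "bihom p q f \<Longrightarrow> bihom p q (\<lambda>z. c * f z)"
| bihom_add: "bihom p q f \<Longrightarrow> bihom p q g \<Longrightarrow> bihom p q (\<lambda>z. f z + g z)"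
| bihom_coord: "bihom p q f \<Longrightarrow> bihom (Suc p) q (\<lambda>z. z $ k * f z)"
| bihom_cnj_coord: "bihom p q f \<Longrightarrow> bihom p (Suc q) (\<lambda>z. cnj (z $ k) * f z)"

lemma bihom_sum: "(\<And>i. i \<in> I \<Longrightarrow> bihom p q (f i)) \<Longrightarrow> bihom p q (\<lambda>z. \<Sum>i\<in>I. f i z)"
  by (induction I rule: infinite_finite_induct) (auto intro: bihom_zero bihom_add)

lemma bihom_0_0: "bihom p q f \<Longrightarrow> p = 0 \<Longrightarrow> q = 0 \<Longrightarrow> \<exists>c. f = (\<lambda>z. c)"
  by (induction rule: bihom.induct) auto

lemma bihom_differentiable: "bihom p q f \<Longrightarrow> f differentiable (at z)"
  by (induction rule: bihom.induct) (auto intro: differentiable_add differentiable_mult)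

lemma bihom_continuous_on: "bihom p q f \<Longrightarrow> continuous_on A f"
  by (metis bihom_differentiable differentiable_imp_continuous_within continuous_at_imp_continuous_on)

text \<open>The clauses for \<open>p = 0\<close> and \<open>q = 0\<close> deal with truncated
  subtraction: there \<open>p - 1 + 1\<close> is not \<open>p\<close>, and
  \<open>z $ k * d_z j f z\<close> has bidegree \<open>(0, q)\<close> only because the derivative
  vanishes identically.\<close>

lemma bihom_wirtinger:
  "bihom p q f \<Longrightarrow> bihom (p - 1) q (d_z j f) \<and> (p = 0 \<longrightarrow> d_z j f = (\<lambda>z. 0))
     \<and> bihom p (q - 1) (d_zbar j f) \<and> (q = 0 \<longrightarrow> d_zbar j f = (\<lambda>z. 0))"
proof (induction rule: bihom.induct)
  case (bihom_zero p q)
  then show ?case by (auto simp: fun_eq_iff intro!: bihom.bihom_zero)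
next
  case bihom_one
  then show ?case by (auto simp: fun_eq_iff intro!: bihom.bihom_zero)
next
  case (bihom_cmult p q f c)
  then have "d_z j (\<lambda>z. c * f z) = (\<lambda>z. c * d_z j f z)"
    "d_zbar j (\<lambda>z. c * f z) = (\<lambda>z. c * d_zbar j f z)"
    by (auto simp: fun_eq_iff wirtinger_cmult bihom_differentiable)
  with bihom_cmult show ?case by (auto intro: bihom.bihom_cmult)
next
  case (bihom_add p q f g)
  then have "d_z j (\<lambda>z. f z + g z) = (\<lambda>z. d_z j f z + d_z j g z)"
    "d_zbar j (\<lambda>z. f z + g z) = (\<lambda>z. d_zbar j f z + d_zbar j g z)"
    by (auto simp: fun_eq_iff wirtinger_add bihom_differentiable)
  with bihom_add show ?case by (auto intro: bihom.bihom_add)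
next
  case (bihom_coord p q f k)
  have eq: "d_z j (\<lambda>z. z $ k * f z) = (\<lambda>z. (if j = k then 1 else 0) * f z + z $ k * d_z j f z)"
    "d_zbar j (\<lambda>z. z $ k * f z) = (\<lambda>z. z $ k * d_zbar j f z)"
    by (auto simp: fun_eq_iff wirtinger_mult bihom_differentiable[OF bihom_coord.hyps])
  have "bihom p q (\<lambda>z. z $ k * d_z j f z)"
    using bihom_coord.IH bihom.bihom_coord[of "p - 1" q "d_z j f" k]
    by (cases "p = 0") (auto intro: bihom.bihom_zero)
  with bihom_coord show ?case
    unfolding eq by (auto intro!: bihom.bihom_add bihom.bihom_coord bihom.bihom_cmult)
next
  case (bihom_cnj_coord p q f k)
  have eq: "d_zbar j (\<lambda>z. cnj (z $ k) * f z)
      = (\<lambda>z. (if j = k then 1 else 0) * f z + cnj (z $ k) * d_zbar j f z)"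
    "d_z j (\<lambda>z. cnj (z $ k) * f z) = (\<lambda>z. cnj (z $ k) * d_z j f z)"
    by (auto simp: fun_eq_iff wirtinger_mult bihom_differentiable[OF bihom_cnj_coord.hyps])
  have "bihom p q (\<lambda>z. cnj (z $ k) * d_zbar j f z)"
    using bihom_cnj_coord.IH bihom.bihom_cnj_coord[of p "q - 1" "d_zbar j f" k]
    by (cases "q = 0") (auto intro: bihom.bihom_zero)
  with bihom_cnj_coord show ?case
    unfolding eq by (auto intro!: bihom.bihom_add bihom.bihom_cnj_coord bihom.bihom_cmult)
qed

lemma bihom_d_z: "bihom p q f \<Longrightarrow> bihom (p - 1) q (d_z j f)"
  and bihom_d_zbar: "bihom p q f \<Longrightarrow> bihom p (q - 1) (d_zbar j f)"
  using bihom_wirtinger by blast+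

text \<open>By the product rule, each additional factor \<open>z $ k\<close> raises the first
  eigenvalue by one and leaves the second unchanged; a conjugate factor does the opposite.\<close>

lemma bihom_euler:
  "bihom p q f \<Longrightarrow> (\<Sum>j\<in>UNIV. z $ j * d_z j f z) = of_nat p * f z
     \<and> (\<Sum>j\<in>UNIV. cnj (z $ j) * d_zbar j f z) = of_nat q * f z"
proof (induction rule: bihom.induct)
  case (bihom_cmult p q f c)
  then show ?case
    by (simp add: wirtinger_cmult bihom_differentiable mult.left_commute sum_distrib_left[symmetric])
next
  case (bihom_add p q f g)
  then show ?case
    by (simp add: wirtinger_add bihom_differentiable distrib_left sum.distrib)
next
  case (bihom_coord p q f k)
  have "(\<Sum>j\<in>UNIV. z $ j * d_z j (\<lambda>z. z $ k * f z) z)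
      = (\<Sum>j\<in>UNIV. (if j = k then z $ k * f z else 0) + z $ k * (z $ j * d_z j f z))"
    "(\<Sum>j\<in>UNIV. cnj (z $ j) * d_zbar j (\<lambda>z. z $ k * f z) z)
      = (\<Sum>j\<in>UNIV. z $ k * (cnj (z $ j) * d_zbar j f z))"
    by (intro sum.cong refl;
        simp add: wirtinger_mult bihom_differentiable[OF bihom_coord.hyps] algebra_simps)+
  with bihom_coord.IH show ?case
    by (simp add: sum.distrib sum_distrib_left[symmetric]) (simp add: algebra_simps)
next
  case (bihom_cnj_coord p q f k)
  have "(\<Sum>j\<in>UNIV. cnj (z $ j) * d_zbar j (\<lambda>z. cnj (z $ k) * f z) z)
      = (\<Sum>j\<in>UNIV. (if j = k then cnj (z $ k) * f z else 0) + cnj (z $ k) * (cnj (z $ j) * d_zbar j f z))"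
    "(\<Sum>j\<in>UNIV. z $ j * d_z j (\<lambda>z. cnj (z $ k) * f z) z)
      = (\<Sum>j\<in>UNIV. cnj (z $ k) * (z $ j * d_z j f z))"
    by (intro sum.cong refl;
        simp add: wirtinger_mult bihom_differentiable[OF bihom_cnj_coord.hyps] algebra_simps)+
  with bihom_cnj_coord.IH show ?case
    by (simp add: sum.distrib sum_distrib_left[symmetric]) (simp add: algebra_simps)
qed simp_all

text \<open>A coordinate of \<open>U *v z\<close> is a linear form in the coordinates of
  \<open>z\<close>, without conjugates, so the substitution respects the degree in \<open>z\<close>
  and the degree in the conjugate variables separately.\<close>

lemma bihom_compose_matrix: "bihom p q f \<Longrightarrow> bihom p q (\<lambda>z. f (U *v z))"
proof (induction rule: bihom.induct)
  case (bihom_coord p q f k)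
  then have "bihom (Suc p) q (\<lambda>z. \<Sum>l\<in>UNIV. U $ k $ l * (z $ l * f (U *v z)))"
    by (intro bihom_sum bihom.intros)
  then show ?case
    by (simp add: matrix_vector_mult_def sum_distrib_right mult.assoc)
next
  case (bihom_cnj_coord p q f k)
  then have "bihom p (Suc q) (\<lambda>z. \<Sum>l\<in>UNIV. cnj (U $ k $ l) * (cnj (z $ l) * f (U *v z)))"
    by (intro bihom_sum bihom.intros)
  then show ?case
    by (simp add: matrix_vector_mult_def sum_distrib_right mult.assoc)
qed (auto intro: bihom.intros)

section \<open>Monomials as a spanning set\<close>

definition monomial :: "('n::finite \<Rightarrow> nat) \<Rightarrow> ('n \<Rightarrow> nat) \<Rightarrow> complex ^ 'n \<Rightarrow> complex" where
  "monomial \<alpha> \<beta> z = (\<Prod>j\<in>UNIV. (z $ j) ^ \<alpha> j) * (\<Prod>j\<in>UNIV. cnj (z $ j) ^ \<beta> j)"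

lemma sum_fun_apply: "(\<Sum>i\<in>I. f i) = (\<lambda>z. \<Sum>i\<in>I. f i z)" for f :: "'i \<Rightarrow> 'a \<Rightarrow> complex"
  by (induction I rule: infinite_finite_induct) (auto simp: fun_eq_iff)

lemma multi_indices_0: "multi_indices 0 = {\<lambda>_. 0}"
  by (auto simp: multi_indices_def)

lemma multi_indices_increment:
  assumes "\<alpha> \<in> multi_indices p"
  shows "\<alpha>(k := Suc (\<alpha> k)) \<in> multi_indices (Suc p)"
  using assms sum.remove[of UNIV k \<alpha>] sum.remove[of UNIV k "\<alpha>(k := Suc (\<alpha> k))"]
  by (simp add: multi_indices_def)

text \<open>A multi-index of positive degree has a positive entry, which can be lowered by one. This
  peels one coordinate off a monomial and drives the inductions on the degree.\<close>

lemma multi_indices_SucE: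
  assumes "\<alpha> \<in> multi_indices (Suc p)"
  obtains \<gamma> k where "\<gamma> \<in> multi_indices p" "\<alpha> = \<gamma>(k := Suc (\<gamma> k))"
proof -
  obtain k where k: "\<alpha> k \<noteq> 0"
    using assms by (force simp: multi_indices_def)
  define \<gamma> where "\<gamma> = \<alpha>(k := \<alpha> k - 1)"
  have "\<gamma> \<in> multi_indices p"
    using assms k sum.remove[of UNIV k \<alpha>] sum.remove[of UNIV k \<gamma>]
    by (simp add: multi_indices_def \<gamma>_def)
  moreover have "\<alpha> = \<gamma>(k := Suc (\<gamma> k))"
    using k by (auto simp: \<gamma>_def)
  ultimately show ?thesis using that by blast
qed

lemma monomial_increment:
  "monomial (\<alpha>(k := Suc (\<alpha> k))) \<beta> z = z $ k * monomial \<alpha> \<beta> z"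
  "monomial \<alpha> (\<beta>(k := Suc (\<beta> k))) z = cnj (z $ k) * monomial \<alpha> \<beta> z"
  by (simp_all add: monomial_def prod.remove[of UNIV k] mult_ac)

lemma bihom_monomial:
  "\<alpha> \<in> multi_indices p \<Longrightarrow> \<beta> \<in> multi_indices q \<Longrightarrow> bihom p q (monomial \<alpha> \<beta>)"
proof (induction p arbitrary: \<alpha>)
  case 0
  from 0(2) show ?case
  proof (induction q arbitrary: \<beta>)
    case 0
    with \<open>\<alpha> \<in> multi_indices 0\<close> have "monomial \<alpha> \<beta> = (\<lambda>z. 1)"
      by (simp add: fun_eq_iff monomial_def multi_indices_0)
    then show ?case using bihom_one by simp
  next
    case (Suc q)
    from Suc.prems obtain \<gamma> k where "\<gamma> \<in> multi_indices q" "\<beta> = \<gamma>(k := Suc (\<gamma> k))"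
      by (rule multi_indices_SucE)
    moreover from this have "monomial \<alpha> \<beta> = (\<lambda>z. cnj (z $ k) * monomial \<alpha> \<gamma> z)"
      by (intro ext) (simp only: monomial_increment)
    ultimately show ?case using bihom_cnj_coord[OF Suc.IH, of \<gamma> k] by metis
  qed
next
  case (Suc p)
  from Suc.prems(1) obtain \<gamma> k where "\<gamma> \<in> multi_indices p" "\<alpha> = \<gamma>(k := Suc (\<gamma> k))"
    by (rule multi_indices_SucE)
  moreover from this have "monomial \<alpha> \<beta> = (\<lambda>z. z $ k * monomial \<gamma> \<beta> z)"
    by (intro ext) (simp only: monomial_increment)
  ultimately show ?case using bihom_coord[OF Suc.IH, of \<gamma> k] Suc.prems by metis
qed

abbreviation monomials :: "nat \<Rightarrow> nat \<Rightarrow> (complex ^ 'n \<Rightarrow> complex) set" where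
  "monomials p q \<equiv> case_prod monomial ` (multi_indices p \<times> multi_indices q)"

lemma bihomogeneous_polys_subset_span:
  "bihomogeneous_polys p q \<subseteq> cfun.span (monomials p q)"
proof
  fix f :: "complex ^ 'n \<Rightarrow> complex" assume "f \<in> bihomogeneous_polys p q"
  then obtain c where "f = (\<lambda>z. \<Sum>\<alpha>\<in>multi_indices p. \<Sum>\<beta>\<in>multi_indices q.
      c \<alpha> \<beta> * (\<Prod>j\<in>UNIV. (z $ j) ^ \<alpha> j) * (\<Prod>j\<in>UNIV. cnj (z $ j) ^ \<beta> j))"
    unfolding bihomogeneous_polys_def by blast
  then have "f = (\<Sum>\<alpha>\<in>multi_indices p. \<Sum>\<beta>\<in>multi_indices q. cscale (c \<alpha> \<beta>) (monomial \<alpha> \<beta>))"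
    by (simp add: sum_fun_apply cscale_def monomial_def mult.assoc)
  moreover have "monomial \<alpha> \<beta> \<in> cfun.span (monomials p q)"
    if "\<alpha> \<in> multi_indices p" "\<beta> \<in> multi_indices q" for \<alpha> \<beta> :: "'n \<Rightarrow> nat"
    using that by (auto intro: cfun.span_base)
  ultimately show "f \<in> cfun.span (monomials p q)"
    by (simp add: cfun.span_sum cfun.span_scale)
qed

lemma bihom_of_span: "f \<in> cfun.span (monomials p q) \<Longrightarrow> bihom p q f"
proof (induction rule: cfun.span_induct_alt)
  case base
  then show ?case using bihom_zero by (simp add: zero_fun_def)
next
  case (step c m f)
  then have "bihom p q (\<lambda>z. c * m z + f z)"
    by (auto intro!: bihom_add bihom_cmult bihom_monomial)
  then show ?case by (simp add: cscale_def plus_fun_def)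
qed

lemma bihomogeneous_polys_of_span:
  "cfun.span (monomials p q) \<subseteq> bihomogeneous_polys p q"
proof (rule cfun.span_minimal)
  show "monomials p q \<subseteq> (bihomogeneous_polys p q :: (complex ^ 'n \<Rightarrow> complex) set)"
  proof clarify
    fix \<alpha> \<beta> :: "'n \<Rightarrow> nat" assume "\<alpha> \<in> multi_indices p" "\<beta> \<in> multi_indices q"
    \<comment> \<open>The coefficient array that is 1 at \<open>(\<alpha>, \<beta>)\<close> and 0
      elsewhere exhibits the monomial in the form demanded by the definition.\<close>
    moreover have "(\<Sum>\<alpha>'\<in>multi_indices p. \<Sum>\<beta>'\<in>multi_indices q.
       (if \<alpha>' = \<alpha> then if \<beta>' = \<beta> then 1 else 0 else 0)
         * (\<Prod>j\<in>UNIV. (z $ j) ^ \<alpha>' j) * (\<Prod>j\<in>UNIV. cnj (z $ j) ^ \<beta>' j))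
     = (\<Sum>\<alpha>'\<in>multi_indices p. if \<alpha>' = \<alpha> then
         (\<Sum>\<beta>'\<in>multi_indices q. if \<beta>' = \<beta> then monomial \<alpha>' \<beta>' z else 0) else 0)" for z
      by (intro sum.cong refl) (auto simp: monomial_def intro!: sum.cong)
    ultimately have "monomial \<alpha> \<beta> = (\<lambda>z. \<Sum>\<alpha>'\<in>multi_indices p. \<Sum>\<beta>'\<in>multi_indices q.
       (if \<alpha>' = \<alpha> then if \<beta>' = \<beta> then 1 else 0 else 0)
         * (\<Prod>j\<in>UNIV. (z $ j) ^ \<alpha>' j) * (\<Prod>j\<in>UNIV. cnj (z $ j) ^ \<beta>' j))"
      by (simp add: finite_multi_indices)
    then show "monomial \<alpha> \<beta> \<in> bihomogeneous_polys p q"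
      unfolding bihomogeneous_polys_def
      by (intro CollectI exI[of _ "\<lambda>\<alpha>' \<beta>'. if \<alpha>' = \<alpha> then if \<beta>' = \<beta> then 1 else 0 else 0"])
  qed
  show "cfun.subspace (bihomogeneous_polys p q :: (complex ^ 'n \<Rightarrow> complex) set)"
  proof (rule cfun.subspaceI)
    show "(0 :: complex ^ 'n \<Rightarrow> complex) \<in> bihomogeneous_polys p q"
      unfolding bihomogeneous_polys_def by (intro CollectI exI[of _ "\<lambda>_ _. 0"]) (simp add: zero_fun_def)
  next
    fix f g :: "complex ^ 'n \<Rightarrow> complex"
    assume "f \<in> bihomogeneous_polys p q" "g \<in> bihomogeneous_polys p q"
    then obtain a b where
      "f = (\<lambda>z. \<Sum>\<alpha>\<in>multi_indices p. \<Sum>\<beta>\<in>multi_indices q.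
        a \<alpha> \<beta> * (\<Prod>j\<in>UNIV. (z $ j) ^ \<alpha> j) * (\<Prod>j\<in>UNIV. cnj (z $ j) ^ \<beta> j))"
      "g = (\<lambda>z. \<Sum>\<alpha>\<in>multi_indices p. \<Sum>\<beta>\<in>multi_indices q.
        b \<alpha> \<beta> * (\<Prod>j\<in>UNIV. (z $ j) ^ \<alpha> j) * (\<Prod>j\<in>UNIV. cnj (z $ j) ^ \<beta> j))"
      unfolding bihomogeneous_polys_def by blast
    then show "f + g \<in> bihomogeneous_polys p q"
      unfolding bihomogeneous_polys_def
      by (intro CollectI exI[of _ "\<lambda>\<alpha> \<beta>. a \<alpha> \<beta> + b \<alpha> \<beta>"])
         (simp add: plus_fun_def distrib_right sum.distrib)
  next
    fix c and f :: "complex ^ 'n \<Rightarrow> complex"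
    assume "f \<in> bihomogeneous_polys p q"
    then obtain a where
      "f = (\<lambda>z. \<Sum>\<alpha>\<in>multi_indices p. \<Sum>\<beta>\<in>multi_indices q.
        a \<alpha> \<beta> * (\<Prod>j\<in>UNIV. (z $ j) ^ \<alpha> j) * (\<Prod>j\<in>UNIV. cnj (z $ j) ^ \<beta> j))"
      unfolding bihomogeneous_polys_def by blast
    then show "cscale c f \<in> bihomogeneous_polys p q"
      unfolding bihomogeneous_polys_def
      by (intro CollectI exI[of _ "\<lambda>\<alpha> \<beta>. c * a \<alpha> \<beta>"])
         (simp add: cscale_def sum_distrib_left mult.assoc)
  qed
qed

lemma span_monomials: "cfun.span (monomials p q) = bihomogeneous_polys p q"
  using bihomogeneous_polys_subset_span bihomogeneous_polys_of_span by blast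

text \<open>Multiplication by a coordinate or its conjugate is linear and raises one exponent of a
  monomial, so it carries the span of one bidegree into the span of the next; the inner inductions
  over the span make this precise.\<close>

lemma span_of_bihom: "bihom p q f \<Longrightarrow> f \<in> cfun.span (monomials p q)"
proof (induction rule: bihom.induct)
  case (bihom_zero p q)
  then show ?case using cfun.span_zero by (simp add: zero_fun_def)
next
  case bihom_one
  have "(\<lambda>z. 1) = monomial (\<lambda>_. 0) (\<lambda>_. 0)" by (simp add: fun_eq_iff monomial_def)
  then show ?case by (auto simp: multi_indices_0 intro: cfun.span_base)
next
  case (bihom_cmult p q f c)
  have "(\<lambda>z. c * f z) = cscale c f" by (simp add: cscale_def)
  with bihom_cmult.IH show ?case by (simp only: cfun.span_scale)
next
  case (bihom_add p q f g)
  have "(\<lambda>z. f z + g z) = f + g" by (simp add: plus_fun_def)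
  with bihom_add.IH show ?case by (simp only: cfun.span_add)
next
  case (bihom_coord p q f k)
  from bihom_coord.IH show ?case
  proof (induction rule: cfun.span_induct_alt)
    case base
    then show ?case using cfun.span_zero by (simp add: zero_fun_def)
  next
    case (step c m f)
    then obtain \<alpha> \<beta> where m: "m = monomial \<alpha> \<beta>" "\<alpha> \<in> multi_indices p" "\<beta> \<in> multi_indices q"
      by auto
    have eq: "(\<lambda>z. z $ k * (cscale c m + f) z)
        = cscale c (monomial (\<alpha>(k := Suc (\<alpha> k))) \<beta>) + (\<lambda>z. z $ k * f z)"
      by (simp add: fun_eq_iff m monomial_increment cscale_def algebra_simps)
    have "monomial (\<alpha>(k := Suc (\<alpha> k))) \<beta> \<in> cfun.span (monomials (Suc p) q)"
      using m multi_indices_increment by (intro cfun.span_base) blast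
    with step show ?case
      unfolding eq by (intro cfun.span_add cfun.span_scale)
  qed
next
  case (bihom_cnj_coord p q f k)
  from bihom_cnj_coord.IH show ?case
  proof (induction rule: cfun.span_induct_alt)
    case base
    then show ?case using cfun.span_zero by (simp add: zero_fun_def)
  next
    case (step c m f)
    then obtain \<alpha> \<beta> where m: "m = monomial \<alpha> \<beta>" "\<alpha> \<in> multi_indices p" "\<beta> \<in> multi_indices q"
      by auto
    have eq: "(\<lambda>z. cnj (z $ k) * (cscale c m + f) z)
        = cscale c (monomial \<alpha> (\<beta>(k := Suc (\<beta> k)))) + (\<lambda>z. cnj (z $ k) * f z)"
      by (simp add: fun_eq_iff m monomial_increment cscale_def algebra_simps)
    have "monomial \<alpha> (\<beta>(k := Suc (\<beta> k))) \<in> cfun.span (monomials p (Suc q))"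
      using m multi_indices_increment by (intro cfun.span_base) blast
    with step show ?case
      unfolding eq by (intro cfun.span_add cfun.span_scale)
  qed
qed

lemma bihomogeneous_polys_iff_bihom: "f \<in> bihomogeneous_polys p q \<longleftrightarrow> bihom p q f"
  using span_of_bihom bihom_of_span span_monomials by blast

subsection \<open>Integrals of harmonic polynomials\<close>

text \<open>By rotation invariance the integral of \<open>f (T t v)\<close> over the sphere does not
  depend on \<open>t\<close>, so its derivative at \<open>t = 0\<close> vanishes. That derivative is
  the integral of \<open>f' v (X v)\<close>, where \<open>X\<close> is the velocity field of the
  rotations at time 0. The bounds \<open>L\<close> and \<open>C\<close> serve to differentiate under
  the integral.\<close>

lemma integral_sphere_measure_generator:
  fixes f :: "'a::euclidean_space \<Rightarrow> complex" and T :: "real \<Rightarrow> 'a \<Rightarrow> 'a"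
  assumes T: "\<And>t. orthogonal_transformation (T t)"
    and T0: "\<And>v. T 0 v = v"
    and deriv_T: "\<And>v. ((\<lambda>t. T t v) has_vector_derivative X v) (at 0)"
    and bound_T: "\<And>t v. norm v = 1 \<Longrightarrow> norm (T t v - v) \<le> C * \<bar>t\<bar>"
    and deriv_f: "\<And>v. (f has_derivative f' v) (at v)"
    and lipschitz_f: "\<And>v w. norm v = 1 \<Longrightarrow> norm w = 1 \<Longrightarrow> norm (f v - f w) \<le> L * norm (v - w)"
    and L: "L \<ge> 0"
    and cont: "continuous_on UNIV (\<lambda>v. f' v (X v))"
  shows "(LINT v|sphere_measure. f' v (X v)) = 0"
proof -
  interpret finite_measure "sphere_measure :: 'a measure" by (rule finite_measure_sphere_measure)
  \<comment> \<open>Difference quotients along the sequence \<open>1 / (n + 1)\<close>: their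
    integrals are all zero, they converge pointwise to \<open>f' v (X v)\<close>, and
    \<open>L * C\<close> dominates them on the sphere.\<close>
  define t where "t n = inverse (real (Suc n))" for n
  define s where "s n v = inverse (t n) *\<^sub>R (f (T (t n) v) - f v)" for n v
  have t_pos: "t n > 0" for n by (simp add: t_def)
  have t_lim: "filterlim t (at 0) sequentially"
    unfolding filterlim_at using t_pos LIMSEQ_inverse_real_of_nat
    by (auto simp: t_def[abs_def] less_imp_neq[THEN not_sym])
  have cont_f: "continuous_on UNIV f"
    using deriv_f has_derivative_continuous_on by blast
  have cont_fT: "continuous_on UNIV (\<lambda>v. f (T r v))" for r
    by (intro continuous_on_compose2[OF cont_f] linear_continuous_on)
       (auto simp: T linear_linear orthogonal_transformation_linear)
  have nT: "norm (T r v) = norm v" for r v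
    using T by (simp add: orthogonal_transformation_norm)
  have "(LINT v|sphere_measure. s n v) = 0" for n
    unfolding s_def using integral_sphere_measure_orthogonal[OF T, of f "t n"] cont_f cont_fT
    by (simp add: integrable_sphere_measure borel_measurable_continuous_onI)
  moreover have "(\<lambda>n. LINT v|sphere_measure. s n v) \<longlonglongrightarrow> (LINT v|sphere_measure. f' v (X v))"
  proof (rule integral_dominated_convergence[where w = "\<lambda>_. L * C"])
    show "(\<lambda>v. f' v (X v)) \<in> borel_measurable sphere_measure"
      using cont by (intro borel_measurable_sphere_measure borel_measurable_continuous_onI)
    show "s n \<in> borel_measurable sphere_measure" for n
      unfolding s_def
      by (intro borel_measurable_sphere_measure borel_measurable_continuous_onI continuous_intros
            cont_f cont_fT)
    show "AE v in sphere_measure. (\<lambda>n. s n v) \<longlonglongrightarrow> f' v (X v)"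
    proof (rule AE_I2)
      fix v
      have "((\<lambda>r. f (T r v)) has_derivative (\<lambda>r. f' (T 0 v) (r *\<^sub>R X v))) (at 0)"
        using deriv_T[of v] unfolding has_vector_derivative_def
        by (rule has_derivative_compose) (rule deriv_f)
      then have "((\<lambda>r. (f (T r v) - f v - f' v (r *\<^sub>R X v)) /\<^sub>R \<bar>r\<bar>) \<longlongrightarrow> 0) (at 0)"
        by (simp add: has_derivative_at_within T0)
      from filterlim_compose[OF this t_lim]
      have "(\<lambda>n. (f (T (t n) v) - f v - f' v (t n *\<^sub>R X v)) /\<^sub>R \<bar>t n\<bar>) \<longlonglongrightarrow> 0" .
      also have "(\<lambda>n. (f (T (t n) v) - f v - f' v (t n *\<^sub>R X v)) /\<^sub>R \<bar>t n\<bar>) = (\<lambda>n. s n v - f' v (X v))"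
        using t_pos linear_cmul[OF has_derivative_linear[OF deriv_f]]
        by (simp add: fun_eq_iff s_def scaleR_diff_right less_imp_neq[THEN not_sym] abs_of_pos)
      finally show "(\<lambda>n. s n v) \<longlonglongrightarrow> f' v (X v)"
        by (simp add: LIM_zero_iff)
    qed
    show "AE v in sphere_measure. norm (s n v) \<le> L * C" for n
    proof (rule AE_I2)
      fix v :: 'a assume "v \<in> space sphere_measure"
      then have v: "norm v = 1" by (simp add: space_sphere_measure)
      have "norm (f (T (t n) v) - f v) \<le> L * norm (T (t n) v - v)"
        using v by (intro lipschitz_f) (simp_all add: nT)
      also have "\<dots> \<le> L * (C * t n)"
        using bound_T[OF v, of "t n"] t_pos[of n] L by (intro mult_left_mono) simp_all
      finally have "norm (f (T (t n) v) - f v) / t n \<le> L * C"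
        using t_pos[of n] by (simp add: pos_divide_le_eq mult_ac)
      moreover have "norm (s n v) = norm (f (T (t n) v) - f v) / t n"
        using t_pos[of n] by (simp add: s_def divide_inverse)
      ultimately show "norm (s n v) \<le> L * C" by simp
    qed
  qed simp
  ultimately show ?thesis
    by (simp add: LIMSEQ_const_iff)
qed

text \<open>For a unit vector \<open>u\<close>, multiplication by \<open>cis t\<close> on the line spanned by \<open>u\<close> and the identity on
  its orthogonal complement.\<close>

definition unit_rotation :: "complex ^ 'n \<Rightarrow> real \<Rightarrow> complex ^ 'n \<Rightarrow> complex ^ 'n" where
  "unit_rotation u t z = (\<chi> j. z $ j + (cis t - 1) * (\<Sum>l\<in>UNIV. z $ l * cnj (u $ l)) * u $ j)"

lemma of_real_norm_vec_square:
  "complex_of_real ((norm (z :: complex ^ 'n))\<^sup>2) = (\<Sum>j\<in>UNIV. z $ j * cnj (z $ j))"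
  by (simp add: norm_vec_def L2_set_def sum_nonneg complex_norm_square[symmetric])

lemma norm_unit_rotation:
  assumes u: "norm u = 1"
  shows "norm (unit_rotation u t z) = norm z"
proof -
  define s where "s = (\<Sum>l\<in>UNIV. z $ l * cnj (u $ l))"
  define w where "w = cis t - 1"
  have uu: "(\<Sum>j\<in>UNIV. u $ j * cnj (u $ j)) = 1"
    using of_real_norm_vec_square[of u] u by simp
  have cs: "cnj s = (\<Sum>l\<in>UNIV. u $ l * cnj (z $ l))"
    by (simp add: s_def mult.commute)
  have "(1 + w) * cnj (1 + w) = 1"
    using complex_norm_square[of "cis t"] by (simp add: w_def)
  \<comment> \<open>Unimodularity of \<open>1 + w = cis t\<close>, written out. Exactly this
    combination is the coefficient of \<open>s * cnj s\<close> when the norm of the rotated vector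
    is expanded.\<close>
  then have w: "w + cnj w + w * cnj w = 0"
    by (simp add: algebra_simps)
  have "complex_of_real ((norm (unit_rotation u t z))\<^sup>2)
      = (\<Sum>j\<in>UNIV. (z $ j + w * s * u $ j) * (cnj (z $ j) + cnj w * cnj s * cnj (u $ j)))"
    unfolding of_real_norm_vec_square unit_rotation_def s_def w_def by simp
  also have "\<dots> = (\<Sum>j\<in>UNIV. z $ j * cnj (z $ j) + cnj w * cnj s * (z $ j * cnj (u $ j))
      + w * s * (u $ j * cnj (z $ j)) + w * s * cnj w * cnj s * (u $ j * cnj (u $ j)))"
    by (intro sum.cong refl) (simp add: algebra_simps)
  also have "\<dots> = (\<Sum>j\<in>UNIV. z $ j * cnj (z $ j)) + cnj w * cnj s * s + w * s * cnj s
      + w * s * cnj w * cnj s * 1"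
    by (simp only: sum.distrib sum_distrib_left[symmetric] uu cs[symmetric] s_def[symmetric])
  also have "\<dots> = (\<Sum>j\<in>UNIV. z $ j * cnj (z $ j)) + (w + cnj w + w * cnj w) * (s * cnj s)"
    by (simp add: algebra_simps)
  also have "\<dots> = complex_of_real ((norm z)\<^sup>2)"
    by (simp only: w of_real_norm_vec_square mult_zero_left add_0_right)
  finally have "(norm (unit_rotation u t z))\<^sup>2 = (norm z)\<^sup>2"
    using of_real_eq_iff by blast
  then show ?thesis by simp
qed

lemma orthogonal_transformation_unit_rotation:
  assumes "norm u = 1"
  shows "orthogonal_transformation (unit_rotation u t)"
proof -
  have "linear (unit_rotation u t)"
  proof (rule linearI)
    show "unit_rotation u t (v + w) = unit_rotation u t v + unit_rotation u t w" for v w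
      by (simp add: unit_rotation_def vec_eq_iff sum.distrib algebra_simps)
    show "unit_rotation u t (r *\<^sub>R v) = r *\<^sub>R unit_rotation u t v" for r v
      by (simp add: unit_rotation_def vec_eq_iff scaleR_sum_right[symmetric] scaleR_add_right)
  qed
  then show ?thesis
    by (simp add: orthogonal_transformation norm_unit_rotation[OF assms])
qed

lemma has_vector_derivative_unit_rotation:
  "((\<lambda>t. unit_rotation u t z) has_vector_derivative
     (\<chi> j. \<i> * (\<Sum>l\<in>UNIV. z $ l * cnj (u $ l)) * u $ j)) (at 0)"
proof -
  define a where "a = (\<chi> j. (\<Sum>l\<in>UNIV. z $ l * cnj (u $ l)) * u $ j)"
  define b where "b = (\<chi> j. \<i> * (\<Sum>l\<in>UNIV. z $ l * cnj (u $ l)) * u $ j)"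
  \<comment> \<open>Separating real and imaginary parts writes the path as a real combination of the
    fixed vectors \<open>a\<close> and \<open>b\<close>, where \<open>b\<close> is
    \<open>\<i>\<close> times \<open>a\<close>; at 0 the cosine term has derivative 0 and the sine
    term has derivative 1.\<close>
  have "cis t - 1 = of_real (cos t - 1) + of_real (sin t) * \<i>" for t
    by (simp add: complex_eq_iff)
  then have "(\<lambda>t. unit_rotation u t z) = (\<lambda>t. z + (cos t - 1) *\<^sub>R a + sin t *\<^sub>R b)"
    by (simp only: fun_eq_iff vec_eq_iff unit_rotation_def a_def b_def vec_lambda_beta
          vector_add_component vector_scaleR_component)
       (simp add: scaleR_conv_of_real algebra_simps)
  moreover have "((\<lambda>t. z + (cos t - 1) *\<^sub>R a + sin t *\<^sub>R b) has_vector_derivative b) (at 0)"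
    by (auto intro!: derivative_eq_intros)
  ultimately show ?thesis by (simp add: b_def)
qed

text \<open>A chord of the unit circle is no longer than its arc; the chord has length
  \<open>2 * \<bar>sin (t / 2)\<bar>\<close>.\<close>

lemma norm_cis_diff_one_le: "norm (cis t - 1) \<le> \<bar>t\<bar>"
proof -
  have "(norm (cis t - 1))\<^sup>2 = (cos t - 1)\<^sup>2 + (sin t)\<^sup>2"
    by (simp add: cmod_power2)
  also have "\<dots> = 2 - 2 * cos t"
    using sin_cos_squared_add[of t] by (simp add: power2_eq_square algebra_simps)
  also have "\<dots> = (2 * \<bar>sin (t / 2)\<bar>)\<^sup>2"
    using cos_double_sin[of "t / 2"] by (simp add: power_mult_distrib)
  also have "\<dots> \<le> \<bar>t\<bar>\<^sup>2"
    using abs_sin_x_le_abs_x[of "t / 2"] by (intro power_mono) auto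
  finally show ?thesis
    by (rule power2_le_imp_le) simp
qed

text \<open>A crude constant is enough, since it only has to be uniform in \<open>z\<close> for
  dominated convergence. One factor \<open>CARD('n)\<close> bounds the inner product with
  \<open>u\<close>, the other counts the coordinates.\<close>

lemma norm_unit_rotation_diff_le:
  fixes u z :: "complex ^ 'n"
  assumes "norm u = 1" "norm z = 1"
  shows "norm (unit_rotation u t z - z) \<le> real CARD('n) * real CARD('n) * \<bar>t\<bar>"
proof -
  have u: "norm (u $ j) \<le> 1" and z: "norm (z $ j) \<le> 1" for j
    using Finite_Cartesian_Product.norm_nth_le[of u j] Finite_Cartesian_Product.norm_nth_le[of z j]
      assms by simp_all
  have s: "norm (\<Sum>l\<in>UNIV. z $ l * cnj (u $ l)) \<le> real CARD('n)"
    using u z by (intro order_trans[OF sum_norm_bound[of _ _ 1]]) (auto simp: norm_mult mult_le_one)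
  have "norm (unit_rotation u t z - z) \<le> (\<Sum>j\<in>UNIV. norm ((unit_rotation u t z - z) $ j))"
    unfolding norm_vec_def by (rule L2_set_le_sum) simp
  also have "\<dots> \<le> (\<Sum>j\<in>(UNIV :: 'n set). \<bar>t\<bar> * real CARD('n) * 1)"
  proof (rule sum_mono)
    fix j
    have "norm ((unit_rotation u t z - z) $ j)
        = norm (cis t - 1) * norm (\<Sum>l\<in>UNIV. z $ l * cnj (u $ l)) * norm (u $ j)"
      by (simp add: unit_rotation_def norm_mult)
    also have "\<dots> \<le> \<bar>t\<bar> * real CARD('n) * 1"
      by (intro mult_mono norm_cis_diff_one_le s u) auto
    finally show "norm ((unit_rotation u t z - z) $ j) \<le> \<bar>t\<bar> * real CARD('n) * 1" .
  qed
  finally show ?thesis by (simp add: mult_ac)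
qed

text \<open>The Wirtinger derivatives are continuous, hence bounded on a compact set, and the mean
  value inequality applies. The argument runs on the closed unit ball because that inequality needs
  a convex domain.\<close>

lemma bihom_lipschitz:
  fixes f :: "complex ^ 'n \<Rightarrow> complex"
  assumes f: "bihom p q f"
  obtains L where "L \<ge> 0" "\<And>v w. norm v = 1 \<Longrightarrow> norm w = 1 \<Longrightarrow> norm (f v - f w) \<le> L * norm (v - w)"
proof -
  \<comment> \<open>The sum of the absolute values of all Wirtinger derivatives at \<open>z\<close>
    bounds the operator norm of the derivative there.\<close>
  define g where "g z = (\<Sum>j\<in>UNIV. norm (d_z j f z) + norm (d_zbar j f z))" for z
  have "continuous_on (cball 0 1) g"
    unfolding g_def
    by (intro continuous_intros bihom_continuous_on[OF bihom_d_z[OF f]]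
        bihom_continuous_on[OF bihom_d_zbar[OF f]])
  then have "bounded (g ` cball 0 1)"
    by (intro compact_imp_bounded compact_continuous_image) auto
  then obtain L where L: "\<And>z. z \<in> cball 0 1 \<Longrightarrow> norm (g z) \<le> L"
    unfolding bounded_iff by blast
  define D where "D z h = (\<Sum>j\<in>UNIV. d_z j f z * h $ j + d_zbar j f z * cnj (h $ j))" for z h
  have "norm (f v - f w) \<le> L * norm (v - w)" if "v \<in> cball 0 1" "w \<in> cball 0 1" for v w
  proof (rule differentiable_bound[of "cball 0 1" f D])
    fix z :: "complex ^ 'n" assume z: "z \<in> cball 0 1"
    show "(f has_derivative D z) (at z within cball 0 1)"
      unfolding D_def
      by (rule has_derivative_at_withinI[OF has_derivative_wirtinger[OF bihom_differentiable[OF f]]])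
    show "onorm (D z) \<le> L"
    proof (rule onorm_le)
      fix h :: "complex ^ 'n"
      have "norm (D z h) \<le> (\<Sum>j\<in>UNIV. (norm (d_z j f z) + norm (d_zbar j f z)) * norm h)"
        unfolding D_def
      proof (intro sum_norm_le)
        fix j
        have "norm (d_z j f z * h $ j + d_zbar j f z * cnj (h $ j))
            \<le> norm (d_z j f z) * norm (h $ j) + norm (d_zbar j f z) * norm (h $ j)"
          by (rule order_trans[OF norm_triangle_ineq]) (simp add: norm_mult)
        also have "\<dots> \<le> norm (d_z j f z) * norm h + norm (d_zbar j f z) * norm h"
          by (intro add_mono mult_left_mono Finite_Cartesian_Product.norm_nth_le) auto
        finally show "norm (d_z j f z * h $ j + d_zbar j f z * cnj (h $ j))
            \<le> (norm (d_z j f z) + norm (d_zbar j f z)) * norm h"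
          by (simp add: algebra_simps)
      qed
      also have "\<dots> = g z * norm h" by (simp add: g_def sum_distrib_right)
      also have "\<dots> \<le> L * norm h"
        using L[OF z] by (intro mult_right_mono) auto
      finally show "norm (D z h) \<le> L * norm h" .
    qed
  qed (use that in auto)
  moreover have "L \<ge> 0"
    using L[of 0] norm_ge_zero[of "g 0"] by auto
  ultimately show ?thesis
    using that by auto
qed

text \<open>Polarisation: real scaling extends the vanishing from unit vectors to all vectors, and a
  complex sesquilinear form that is zero on the diagonal is zero.\<close>

lemma hermitian_form_eq_zero:
  fixes I :: "'n::finite \<Rightarrow> 'n \<Rightarrow> complex"
  assumes "\<And>u :: complex ^ 'n. norm u = 1 \<Longrightarrow> (\<Sum>l\<in>UNIV. \<Sum>m\<in>UNIV. u $ l * cnj (u $ m) * I m l) = 0"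
  shows "I j k = 0"
proof -
  define Q where "Q u v = (\<Sum>l\<in>UNIV. \<Sum>m\<in>UNIV. u $ l * cnj (v $ m) * I m l)" for u v :: "complex ^ 'n"
  have Q0: "Q u u = 0" for u
  proof (cases "u = 0")
    case True
    then show ?thesis by (simp add: Q_def)
  next
    case False
    have "Q (r *\<^sub>R v) (r *\<^sub>R v) = r *\<^sub>R r *\<^sub>R Q v v" for r v
      by (simp add: Q_def scaleR_sum_right)
    from this[of "norm u" "sgn u"] show ?thesis
      using assms[of "sgn u"] False by (simp add: Q_def norm_sgn sgn_div_norm)
  qed
  have Qadd: "Q (u + v) (u + v) = Q u u + Q u v + (Q v u + Q v v)" for u v
    by (simp add: Q_def algebra_simps sum.distrib)
  have Qaxis: "Q (axis l x) (axis m y) = x * cnj y * I m l" for l m x y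
  proof -
    have *: "x * cnj (if m' = m then y else 0) * I m' l = (if m' = m then x * cnj y * I m' l else 0)" for m'
      by simp
    have "Q (axis l x) (axis m y)
        = (\<Sum>l'\<in>UNIV. if l' = l then (\<Sum>m'\<in>UNIV. if m' = m then x * cnj y * I m' l' else 0) else 0)"
      unfolding Q_def by (intro sum.cong refl) (auto simp: axis_def * simp del: sum.delta sum.delta')
    then show ?thesis by simp
  qed
  \<comment> \<open>The vectors \<open>axis k 1 + axis j 1\<close> and
    \<open>axis k 1 + axis j \<i>\<close> show that the sum and the difference of the two mixed
    entries vanish. For \<open>j = k\<close> the first of them already suffices.\<close>
  have "I j k + I k j = 0"
    using Qadd[of "axis k 1" "axis j 1"] by (simp add: Q0 Qaxis)
  moreover have "- \<i> * I j k + \<i> * I k j = 0"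
    using Qadd[of "axis k 1" "axis j \<i>"] by (simp add: Q0 Qaxis)
  then have "I k j = I j k" by simp
  ultimately show ?thesis by simp
qed

text \<open>The operators \<open>E\<^sub>j\<^sub>k\<close> of the overview, that is, the
  infinitesimal action of the matrix units on functions. They preserve the bidegree.\<close>

definition ladder :: "'n::finite \<Rightarrow> 'n \<Rightarrow> (complex ^ 'n \<Rightarrow> complex) \<Rightarrow> complex ^ 'n \<Rightarrow> complex" where
  "ladder j k f z = z $ j * d_z k f z - cnj (z $ k) * d_zbar j f z"

lemma integrable_ladder:
  assumes "bihom p q f"
  shows "integrable sphere_measure (ladder j k f)"
  unfolding ladder_def
  by (intro integrable_sphere_measure continuous_intros bihom_continuous_on[OF bihom_d_z[OF assms]]
      bihom_continuous_on[OF bihom_d_zbar[OF assms]])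

text \<open>The generator of the rotations about \<open>u\<close> is \<open>\<i> \<Sum>\<^sub>l\<^sub>m u\<^sub>l cnj u\<^sub>m E\<^sub>m\<^sub>l\<close>; polarisation in \<open>u\<close> isolates
  the individual operators.\<close>

lemma integral_ladder_eq_zero:
  fixes f :: "complex ^ 'n \<Rightarrow> complex"
  assumes f: "bihom p q f"
  shows "(LINT v|sphere_measure. ladder j k f v) = 0"
proof (rule hermitian_form_eq_zero)
  fix u :: "complex ^ 'n" assume u: "norm u = 1"
  define X where "X z = (\<chi> j. \<i> * (\<Sum>l\<in>UNIV. z $ l * cnj (u $ l)) * u $ j)" for z
  define D where "D z h = (\<Sum>j\<in>UNIV. d_z j f z * h $ j + d_zbar j f z * cnj (h $ j))" for z h
  have eq: "D z (X z) = \<i> * (\<Sum>l\<in>UNIV. \<Sum>m\<in>UNIV. u $ l * cnj (u $ m) * ladder m l f z)" for z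
  proof -
    have "D z (X z) = (\<Sum>l\<in>UNIV. \<Sum>m\<in>UNIV. \<i> * (u $ l * cnj (u $ m) * (z $ m * d_z l f z)))
        - (\<Sum>l\<in>UNIV. \<Sum>m\<in>UNIV. \<i> * (u $ m * cnj (u $ l) * (cnj (z $ m) * d_zbar l f z)))"
      by (simp add: D_def X_def sum.distrib sum_subtractf sum_distrib_left sum_distrib_right
          sum_negf mult_ac)
    \<comment> \<open>The conjugate terms carry the coefficient with \<open>l\<close> and
      \<open>m\<close> exchanged; renaming the indices aligns it with the first sum, and the two
      combine to \<open>ladder m l f\<close>.\<close>
    also have "(\<Sum>l\<in>UNIV. \<Sum>m\<in>UNIV. \<i> * (u $ m * cnj (u $ l) * (cnj (z $ m) * d_zbar l f z)))
        = (\<Sum>l\<in>UNIV. \<Sum>m\<in>UNIV. \<i> * (u $ l * cnj (u $ m) * (cnj (z $ l) * d_zbar m f z)))"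
      by (rule sum.swap)
    finally show ?thesis
      by (simp add: ladder_def sum_distrib_left sum_subtractf right_diff_distrib)
  qed
  have cont: "continuous_on UNIV (\<lambda>z. D z (X z))"
    unfolding eq ladder_def
    by (intro continuous_intros bihom_continuous_on[OF bihom_d_z[OF f]]
        bihom_continuous_on[OF bihom_d_zbar[OF f]])
  obtain L where L: "L \<ge> 0"
    "\<And>v w. norm v = 1 \<Longrightarrow> norm w = 1 \<Longrightarrow> norm (f v - f w) \<le> L * norm (v - w)"
    using bihom_lipschitz[OF f] by blast
  have "(LINT v|sphere_measure. D v (X v)) = 0"
  proof (rule integral_sphere_measure_generator[where T = "unit_rotation u" and f = f])
    show "((\<lambda>t. unit_rotation u t v) has_vector_derivative X v) (at 0)" for v
      unfolding X_def by (rule has_vector_derivative_unit_rotation)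
    show "(f has_derivative D v) (at v)" for v
      unfolding D_def by (intro has_derivative_wirtinger bihom_differentiable[OF f])
    show "unit_rotation u 0 v = v" for v by (simp add: unit_rotation_def)
  qed (use u L cont norm_unit_rotation_diff_le orthogonal_transformation_unit_rotation in auto)
  also have "(LINT v|sphere_measure. D v (X v))
      = \<i> * (\<Sum>l\<in>UNIV. \<Sum>m\<in>UNIV. u $ l * cnj (u $ m) * (LINT v|sphere_measure. ladder m l f v))"
    unfolding eq by (simp add: integrable_ladder[OF f])
  finally show "(\<Sum>l\<in>UNIV. \<Sum>m\<in>UNIV. u $ l * cnj (u $ m) * (LINT v|sphere_measure. ladder m l f v)) = 0"
    by simp
qed

section \<open>Euler and Laplace identities for the ladder operators\<close>

lemma sum_ladder_diagonal:
  assumes "bihom p q f"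
  shows "(\<Sum>j\<in>UNIV. ladder j j f z) = (of_nat p - of_nat q) * f z"
  using bihom_euler[OF assms, of z] by (simp add: ladder_def sum_subtractf left_diff_distrib)

text \<open>The product rule followed by Euler's identity twice, for \<open>f\<close> and for
  \<open>d_zbar k f\<close>. The degree in the conjugate variables is \<open>Suc q\<close> here, so
  the constant \<open>q (d + q - 1)\<close> of the overview reads
  \<open>(q + 1) (d + q)\<close>.\<close>

lemma sum_ladder_laplacian:
  fixes f :: "complex ^ 'n \<Rightarrow> complex"
  assumes f: "bihom p (Suc q) f"
  shows "(\<Sum>j\<in>UNIV. \<Sum>k\<in>UNIV. ladder j k (\<lambda>z. cnj (z $ j) * d_zbar k f z) z)
    = of_real ((norm z)\<^sup>2) * (\<Sum>k\<in>UNIV. d_z k (d_zbar k f) z)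
      - of_nat (Suc q) * of_nat (CARD('n) + q) * f z"
proof -
  have fk: "bihom p q (d_zbar k f)" for k
    using bihom_d_zbar[OF f] by simp
  have E1: "(\<Sum>k\<in>UNIV. cnj (z $ k) * d_zbar k f z) = of_nat (Suc q) * f z"
    using bihom_euler[OF f, of z] by simp
  have E2: "(\<Sum>j\<in>UNIV. cnj (z $ j) * d_zbar j (d_zbar k f) z) = of_nat q * d_zbar k f z" for k
    using bihom_euler[OF fk, of z] by simp
  \<comment> \<open>The derivative \<open>d_z k\<close> passes through the factor
    \<open>cnj (z $ j)\<close>, whereas \<open>d_zbar j\<close> also hits it. The extra term does
    not depend on \<open>j\<close> and produces the factor \<open>CARD('n)\<close> below.\<close>
  have "(\<Sum>j\<in>UNIV. \<Sum>k\<in>UNIV. ladder j k (\<lambda>z. cnj (z $ j) * d_zbar k f z) z)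
      = (\<Sum>j\<in>UNIV. \<Sum>k\<in>UNIV. (z $ j * cnj (z $ j)) * d_z k (d_zbar k f) z
          - cnj (z $ k) * d_zbar k f z
          - cnj (z $ k) * (cnj (z $ j) * d_zbar j (d_zbar k f) z))"
    by (intro sum.cong refl)
       (simp add: ladder_def wirtinger_mult bihom_differentiable[OF fk] algebra_simps)
  also have "\<dots> = (\<Sum>j\<in>UNIV. \<Sum>k\<in>UNIV. (z $ j * cnj (z $ j)) * d_z k (d_zbar k f) z)
      - (\<Sum>j\<in>(UNIV :: 'n set). \<Sum>k\<in>UNIV. cnj (z $ k) * d_zbar k f z)
      - (\<Sum>j\<in>UNIV. \<Sum>k\<in>UNIV. cnj (z $ k) * (cnj (z $ j) * d_zbar j (d_zbar k f) z))"
    by (simp only: sum_subtractf)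
  also have "(\<Sum>j\<in>UNIV. \<Sum>k\<in>UNIV. (z $ j * cnj (z $ j)) * d_z k (d_zbar k f) z)
      = of_real ((norm z)\<^sup>2) * (\<Sum>k\<in>UNIV. d_z k (d_zbar k f) z)"
    by (simp only: of_real_norm_vec_square sum_product)
  also have "(\<Sum>j\<in>(UNIV :: 'n set). \<Sum>k\<in>UNIV. cnj (z $ k) * d_zbar k f z)
      = of_nat CARD('n) * (of_nat (Suc q) * f z)"
    by (simp only: E1) simp
  also have "(\<Sum>j\<in>UNIV. \<Sum>k\<in>UNIV. cnj (z $ k) * (cnj (z $ j) * d_zbar j (d_zbar k f) z))
      = (\<Sum>k\<in>UNIV. cnj (z $ k) * (\<Sum>j\<in>UNIV. cnj (z $ j) * d_zbar j (d_zbar k f) z))"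
    by (subst sum.swap) (simp only: sum_distrib_left)
  also have "\<dots> = of_nat q * (\<Sum>k\<in>UNIV. cnj (z $ k) * d_zbar k f z)"
    by (simp only: E2 sum_distrib_left mult_ac)
  also have "\<dots> = of_nat q * (of_nat (Suc q) * f z)"
    by (simp only: E1)
  finally show ?thesis by (simp add: algebra_simps)
qed

lemma integral_harmonic_eq_zero:
  fixes f :: "complex ^ 'n \<Rightarrow> complex"
  assumes f: "bihom p q f" and harm: "\<And>z. (\<Sum>j\<in>UNIV. d_z j (d_zbar j f) z) = 0"
    and pq: "(p, q) \<noteq> (0, 0)"
  shows "(LINT v|sphere_measure. f v) = 0"
proof (cases q)
  case 0
  have "(LINT v|sphere_measure. (\<Sum>j\<in>UNIV. ladder j j f v)) = 0"
    by (simp add: integrable_ladder[OF f] integral_ladder_eq_zero[OF f])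
  then show ?thesis
    using pq 0 by (simp add: sum_ladder_diagonal[OF f])
next
  case (Suc r)
  \<comment> \<open>The factor \<open>cnj (z $ j)\<close> restores the degree lost to
    \<open>d_zbar k\<close>; this uses \<open>q > 0\<close>, since otherwise
    \<open>Suc (q - 1)\<close> is not \<open>q\<close>.\<close>
  have g: "bihom p q (\<lambda>z. cnj (z $ j) * d_zbar k f z)" for j k
    using bihom_cnj_coord[OF bihom_d_zbar[OF f], of j k] Suc by simp
  have "(LINT v|sphere_measure.
      (\<Sum>j\<in>UNIV. \<Sum>k\<in>UNIV. ladder j k (\<lambda>z. cnj (z $ j) * d_zbar k f z) v)) = 0"
    by (simp add: integrable_ladder[OF g] integral_ladder_eq_zero[OF g])
  \<comment> \<open>The Laplacian term drops out by harmonicity, so this nonzero multiple of the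
    integral of \<open>f\<close> is zero.\<close>
  moreover have "complex_of_nat (Suc r) * complex_of_nat (CARD('n) + r) \<noteq> 0"
    unfolding of_nat_mult[symmetric] of_nat_eq_0_iff by simp
  ultimately show ?thesis
    using f unfolding Suc by (simp add: sum_ladder_laplacian harm del: of_nat_Suc of_nat_add)
qed

subsection \<open>Orbit averages\<close>

lemma harmonic_polys_iff:
  "f \<in> harmonic_polys p q \<longleftrightarrow> bihom p q f \<and> (\<forall>z. (\<Sum>j\<in>UNIV. d_z j (d_zbar j f) z) = 0)"
  by (simp add: harmonic_polys_def bihomogeneous_polys_iff_bihom)

lemma zero_in_harmonic_polys: "(\<lambda>z::complex ^ 'n. 0) \<in> harmonic_polys p q"
proof -
  have "d_zbar j (\<lambda>z. 0) = (\<lambda>z. 0)" for j :: 'n by (simp add: fun_eq_iff)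
  then show ?thesis by (simp add: harmonic_polys_iff bihom_zero)
qed

lemma harmonic_polys_sum:
  assumes "\<And>i. i \<in> I \<Longrightarrow> f i \<in> harmonic_polys p q"
  shows "(\<lambda>z. \<Sum>i\<in>I. f i z) \<in> harmonic_polys p q"
proof -
  have f: "bihom p q (f i)" if "i \<in> I" for i using assms[OF that] by (simp add: harmonic_polys_iff)
  have "d_zbar j (\<lambda>z. \<Sum>i\<in>I. f i z) = (\<lambda>z. \<Sum>i\<in>I. d_zbar j (f i) z)" for j
    by (simp add: fun_eq_iff wirtinger_sum bihom_differentiable[OF f])
  then have "(\<Sum>j\<in>UNIV. d_z j (d_zbar j (\<lambda>z. \<Sum>i\<in>I. f i z)) z)
      = (\<Sum>j\<in>UNIV. \<Sum>i\<in>I. d_z j (d_zbar j (f i)) z)" for z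
    by (simp add: wirtinger_sum bihom_differentiable[OF bihom_d_zbar[OF f]])
  also have "(\<Sum>j\<in>UNIV. \<Sum>i\<in>I. d_z j (d_zbar j (f i)) z)
      = (\<Sum>i\<in>I. \<Sum>j\<in>UNIV. d_z j (d_zbar j (f i)) z)" for z
    by (rule sum.swap)
  also have "\<dots> z = 0" for z
    using assms by (intro sum.neutral) (simp add: harmonic_polys_iff)
  finally show ?thesis
    using f by (simp add: harmonic_polys_iff bihom_sum)
qed

text \<open>By the chain rule, the Laplacian of the composition contracts the second derivatives
  \<open>d_z l (d_zbar k f)\<close> with the entries of \<open>U ** conj_transpose U\<close>, which
  is the identity matrix. Hence the Laplacian commutes with unitary substitutions.\<close>

lemma harmonic_polys_compose_unitary:
  fixes U :: "complex ^ 'n ^ 'n"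
  assumes f: "f \<in> harmonic_polys p q" and U: "U \<in> carrier unitary_group"
  shows "(\<lambda>z. f (U *v z)) \<in> harmonic_polys p q"
proof -
  have bf: "bihom p q f" using f by (simp add: harmonic_polys_iff)
  have "U ** conj_transpose U = mat 1" using U by (simp add: unitary_group_def)
  then have orth: "(\<Sum>j\<in>UNIV. U $ l $ j * cnj (U $ k $ j)) = (if l = k then 1 else 0)" for k l
    by (simp add: vec_eq_iff matrix_matrix_mult_def conj_transpose_def mat_def)
  have *: "d_zbar j (\<lambda>z. f (U *v z)) = (\<lambda>z. \<Sum>k\<in>UNIV. cnj (U $ k $ j) * d_zbar k f (U *v z))" for j
    by (simp add: fun_eq_iff wirtinger_compose_matrix bihom_differentiable[OF bf])
  have "d_z j (d_zbar j (\<lambda>z. f (U *v z))) z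
      = (\<Sum>k\<in>UNIV. cnj (U $ k $ j) * (\<Sum>l\<in>UNIV. U $ l $ j * d_z l (d_zbar k f) (U *v z)))" for j z
    unfolding *
    by (simp add: wirtinger_sum wirtinger_cmult wirtinger_compose_matrix differentiable_compose_matrix
        bihom_differentiable[OF bihom_d_zbar[OF bf]] differentiable_mult)
  then have "(\<Sum>j\<in>UNIV. d_z j (d_zbar j (\<lambda>z. f (U *v z))) z)
      = (\<Sum>j\<in>UNIV. \<Sum>k\<in>UNIV. \<Sum>l\<in>UNIV. (U $ l $ j * cnj (U $ k $ j)) * d_z l (d_zbar k f) (U *v z))" for z
    by (simp add: sum_distrib_left mult_ac)
  also have "\<dots> z = (\<Sum>k\<in>UNIV. \<Sum>l\<in>UNIV. \<Sum>j\<in>UNIV.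
      (U $ l $ j * cnj (U $ k $ j)) * d_z l (d_zbar k f) (U *v z))" for z
    by (subst sum.swap) (intro sum.cong refl sum.swap)
  also have "\<dots> z = (\<Sum>k\<in>UNIV. \<Sum>l\<in>UNIV. (if l = k then 1 else 0) * d_z l (d_zbar k f) (U *v z))" for z
    by (simp only: sum_distrib_right[symmetric] orth)
  also have "\<dots> z = (\<Sum>k\<in>UNIV. d_z k (d_zbar k f) (U *v z))" for z
    by (simp add: if_distrib if_distribR cong: if_cong)
  also have "\<dots> z = 0" for z
    using f by (simp add: harmonic_polys_iff)
  finally show ?thesis
    using bf by (simp add: harmonic_polys_iff bihom_compose_matrix)
qed

lemma norm_unitary_mult:
  fixes U :: "complex ^ 'n ^ 'n"
  assumes "U \<in> carrier unitary_group"
  shows "norm (U *v z) = norm z"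
proof -
  have "conj_transpose U ** U = mat 1" using assms by (simp add: unitary_group_def)
  then have orth: "(\<Sum>j\<in>UNIV. cnj (U $ j $ k) * U $ j $ l) = (if k = l then 1 else 0)" for k l
    by (simp add: vec_eq_iff matrix_matrix_mult_def conj_transpose_def mat_def)
  have "complex_of_real ((norm (U *v z))\<^sup>2)
      = (\<Sum>j\<in>UNIV. \<Sum>l\<in>UNIV. \<Sum>k\<in>UNIV. (cnj (U $ j $ k) * U $ j $ l) * (z $ l * cnj (z $ k)))"
    unfolding of_real_norm_vec_square matrix_vector_mult_def by (simp add: sum_product mult_ac)
  also have "\<dots> = (\<Sum>l\<in>UNIV. \<Sum>k\<in>UNIV. \<Sum>j\<in>UNIV. (cnj (U $ j $ k) * U $ j $ l) * (z $ l * cnj (z $ k)))"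
    by (subst sum.swap) (intro sum.cong refl sum.swap)
  also have "\<dots> = (\<Sum>l\<in>UNIV. \<Sum>k\<in>UNIV. (if k = l then 1 else 0) * (z $ l * cnj (z $ k)))"
    by (simp only: sum_distrib_right[symmetric] orth)
  also have "\<dots> = complex_of_real ((norm z)\<^sup>2)"
    unfolding of_real_norm_vec_square by (simp add: if_distrib if_distribR cong: if_cong)
  finally have "(norm (U *v z))\<^sup>2 = (norm z)\<^sup>2"
    using of_real_eq_iff by blast
  then show ?thesis by simp
qed

section \<open>The spaces \<open>H p q\<close> on the sphere and the dimension of their
  invariants\<close>

lemma H_subset_span: "H p q \<subseteq> cfun.span (on_sphere ` monomials p q)"
proof
  fix h :: "complex ^ 'n \<Rightarrow> complex" assume "h \<in> H p q"
  then obtain f where h: "h = on_sphere f" and f: "f \<in> cfun.span (monomials p q)"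
    by (auto simp: H_def harmonic_polys_def span_monomials)
  from f have "on_sphere f \<in> cfun.span (on_sphere ` monomials p q)"
  proof (induction rule: cfun.span_induct_alt)
    case base
    have "on_sphere 0 = 0" by (simp add: on_sphere_def fun_eq_iff)
    then show ?case using cfun.span_zero by metis
  next
    case (step c m f)
    have eq: "on_sphere (cscale c m + f) = cscale c (on_sphere m) + on_sphere f"
      by (simp add: on_sphere_def cscale_def fun_eq_iff)
    have "on_sphere m \<in> cfun.span (on_sphere ` monomials p q)"
      using step by (intro cfun.span_base imageI)
    with step show ?case
      unfolding eq by (intro cfun.span_add cfun.span_scale)
  qed
  then show "h \<in> cfun.span (on_sphere ` monomials p q)" by (simp add: h)
qed

lemma integral_H_eq_zero:
  fixes f :: "complex ^ 'n \<Rightarrow> complex"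
  assumes "f \<in> H p q" "(p, q) \<noteq> (0, 0)"
  shows "(LINT v|sphere_measure. f v) = 0"
proof -
  obtain h where "f = on_sphere h" "h \<in> harmonic_polys p q"
    using assms(1) by (auto simp: H_def)
  then show ?thesis
    using integral_harmonic_eq_zero[of p q h] assms(2)
    by (simp add: integral_sphere_measure_on_sphere harmonic_polys_iff)
qed

lemma integrable_H:
  fixes f :: "complex ^ 'n \<Rightarrow> complex"
  assumes "f \<in> H p q"
  shows "integrable sphere_measure f"
proof -
  obtain h where h: "f = on_sphere h" "bihom p q h"
    using assms by (auto simp: H_def harmonic_polys_iff)
  have "integrable sphere_measure h"
    by (intro integrable_sphere_measure bihom_continuous_on[OF h(2)])
  then show ?thesis
    unfolding h(1)
    by (subst Bochner_Integration.integrable_cong[OF refl, of _ _ h])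
       (auto simp: space_sphere_measure on_sphere_def)
qed

lemma zero_in_H_inv: "0 \<in> H_inv G \<rho> p q"
proof -
  have "0 = on_sphere (\<lambda>z. 0)" by (simp add: on_sphere_def fun_eq_iff)
  then have "0 \<in> H p q" unfolding H_def using zero_in_harmonic_polys by blast
  then show ?thesis by (simp add: H_inv_def fun_act_def fun_eq_iff)
qed

text \<open>The spanning set is needed because the dimension of an infinite-dimensional space is
  \<open>0\<close> as well.\<close>

lemma dim_H_inv_eq_0_iff:
  fixes \<rho> :: "'g \<Rightarrow> complex ^ 'n ^ 'n"
  shows "cfun.dim (H_inv G \<rho> p q) = 0 \<longleftrightarrow> H_inv G \<rho> p q = {0}"
proof -
  obtain B where B: "B \<subseteq> H_inv G \<rho> p q" "cfun.independent B"
    "H_inv G \<rho> p q \<subseteq> cfun.span B" "card B = cfun.dim (H_inv G \<rho> p q)"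
    by (rule cfun.basis_exists)
  have "B \<subseteq> cfun.span (on_sphere ` monomials p q)"
    using B(1) H_subset_span unfolding H_inv_def by blast
  moreover have "finite (on_sphere ` monomials p q :: (complex ^ 'n \<Rightarrow> complex) set)"
    by (intro finite_imageI finite_cartesian_product finite_multi_indices)
  ultimately have "finite B"
    using cfun.independent_span_bound[OF _ B(2)] by blast
  then show ?thesis
  proof (intro iffI)
    assume "cfun.dim (H_inv G \<rho> p q) = 0"
    with B(4) \<open>finite B\<close> have "B = {}" by simp
    with B(3) zero_in_H_inv[of G \<rho> p q] show "H_inv G \<rho> p q = {0}"
      by auto
  next
    assume "H_inv G \<rho> p q = {0}"
    with B(1) have "B = {} \<or> 0 \<in> B" by auto
    with B(2) cfun.dependent_zero[of B] have "B = {}" by auto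
    with B(4) show "cfun.dim (H_inv G \<rho> p q) = 0" by simp
  qed
qed

section \<open>A finite group acting unitarily\<close>

context
  fixes G :: "('g, 'm) monoid_scheme" and \<rho> :: "'g \<Rightarrow> complex ^ 'n ^ 'n"
  assumes G: "group G" and fin: "finite (carrier G)" and hom: "\<rho> \<in> hom G unitary_group"
begin

interpretation group G by (rule G)

lemma rho_unitary: "g \<in> carrier G \<Longrightarrow> \<rho> g \<in> carrier unitary_group"
  using hom by (rule hom_in_carrier)

lemma rho_mult: "g \<in> carrier G \<Longrightarrow> h \<in> carrier G \<Longrightarrow> \<rho> (g \<otimes>\<^bsub>G\<^esub> h) *v v = \<rho> g *v (\<rho> h *v v)"
  using hom by (simp add: hom_def unitary_group_def matrix_vector_mul_assoc)

lemma norm_rho: "g \<in> carrier G \<Longrightarrow> norm (\<rho> g *v v) = norm v"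
  by (rule norm_unitary_mult[OF rho_unitary])

text \<open>This is the averaging operator without its factor \<open>1 / card (carrier G)\<close>.
  Harmonicity survives each unitary substitution, and the sum over the group absorbs
  translations.\<close>

lemma orbit_sum_in_H_inv:
  assumes f: "f \<in> harmonic_polys p q"
  shows "on_sphere (\<lambda>v. \<Sum>g\<in>carrier G. f (\<rho> g *v v)) \<in> H_inv G \<rho> p q"
proof -
  let ?s = "\<lambda>v. \<Sum>g\<in>carrier G. f (\<rho> g *v v)"
  have "?s \<in> harmonic_polys p q"
    by (intro harmonic_polys_sum harmonic_polys_compose_unitary[OF f] rho_unitary)
  moreover have "fun_act G \<rho> g (on_sphere ?s) = on_sphere ?s" if g: "g \<in> carrier G" for g
  proof
    fix v
    have "?s (\<rho> (inv\<^bsub>G\<^esub> g) *v v) = (\<Sum>h\<in>carrier G. f (\<rho> (h \<otimes>\<^bsub>G\<^esub> inv\<^bsub>G\<^esub> g) *v v))"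
      using g by (intro sum.cong refl) (simp add: rho_mult)
    also have "\<dots> = ?s v"
      \<comment> \<open>Right translation by the inverse of \<open>g\<close> permutes the
        group.\<close>
      by (rule sum.reindex_bij_witness[of _ "\<lambda>h. h \<otimes>\<^bsub>G\<^esub> g" "\<lambda>h. h \<otimes>\<^bsub>G\<^esub> inv\<^bsub>G\<^esub> g"])
         (use g in \<open>auto simp: m_assoc\<close>)
    finally show "fun_act G \<rho> g (on_sphere ?s) v = on_sphere ?s v"
      using g by (simp add: fun_act_def on_sphere_def norm_rho)
  qed
  ultimately show ?thesis by (simp add: H_inv_def H_def)
qed

lemma H_inv_orbit_sum:
  assumes "f \<in> H_inv G \<rho> p q"
  shows "(\<Sum>g\<in>carrier G. f (\<rho> g *v v)) = of_nat (card (carrier G)) * f v"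
proof -
  have "f (\<rho> g *v v) = f v" if g: "g \<in> carrier G" for g
  proof -
    \<comment> \<open>Invariance is used at the inverse of \<open>g\<close>, because
      \<open>fun_act\<close> inverts its argument.\<close>
    have "fun_act G \<rho> (inv\<^bsub>G\<^esub> g) f = f" using assms g by (simp add: H_inv_def)
    then show ?thesis using g by (simp add: fun_act_def fun_eq_iff)
  qed
  then show ?thesis by simp
qed

text \<open>In bidegree \<open>(0, 0)\<close> the function is constant on the sphere. In any other
  bidegree of \<open>tau_G G \<rho>\<close> both sides are zero: the orbit sum is an invariant
  element and there is none but 0, and the integral vanishes by
  \<open>integral_H_eq_zero\<close>.\<close>

lemma orbit_average_eq_integral:
  assumes f: "f \<in> H p q" and pq: "(p, q) \<in> tau_G G \<rho>" and v: "v \<in> sphere 0 1"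
  shows "(\<Sum>g\<in>carrier G. f (\<rho> g *v v)) / of_nat (card (carrier G)) = (LINT v|sphere_measure. f v)"
proof -
  obtain h where h: "f = on_sphere h" "h \<in> harmonic_polys p q"
    using f by (auto simp: H_def)
  \<comment> \<open>The orbit stays on the sphere, where \<open>f\<close> agrees with the polynomial
    \<open>h\<close>.\<close>
  have sum_eq: "(\<Sum>g\<in>carrier G. f (\<rho> g *v v)) = (\<Sum>g\<in>carrier G. h (\<rho> g *v v))"
    using v by (intro sum.cong refl) (simp add: h(1) on_sphere_def norm_rho)
  show ?thesis
  proof (cases "(p, q) = (0, 0)")
    case True
    then obtain c where "h = (\<lambda>z. c)"
      using h(2) bihom_0_0[of p q h] by (auto simp: harmonic_polys_iff)
    moreover have "card (carrier G) \<noteq> 0"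
      using fin carrier_not_empty by simp
    ultimately show ?thesis
      unfolding sum_eq unfolding h(1) integral_sphere_measure_on_sphere
      by (simp add: integral_sphere_measure_const del: lebesgue_integral_const)
  next
    case False
    with pq orbit_sum_in_H_inv[OF h(2)]
    have "on_sphere (\<lambda>v. \<Sum>g\<in>carrier G. h (\<rho> g *v v)) = 0"
      by (auto simp: tau_G_def)
    then have "on_sphere (\<lambda>v. \<Sum>g\<in>carrier G. h (\<rho> g *v v)) v = 0" by simp
    with v have "(\<Sum>g\<in>carrier G. h (\<rho> g *v v)) = 0"
      by (simp add: on_sphere_def)
    with False f show ?thesis
      by (simp add: sum_eq integral_H_eq_zero)
  qed
qed

text \<open>Orbit average and integral are both linear, so the design identity reduces to the single
  summands in \<open>H p q\<close>.\<close>

lemma spherical_design_orbit_of_subset: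
  assumes "\<tau> \<subseteq> tau_G G \<rho>" and v: "v \<in> sphere 0 1"
  shows "spherical_design \<tau> (carrier G) (\<lambda>g. \<rho> g *v v)"
  unfolding spherical_design_def
proof (intro conjI ballI fin)
  show "carrier G \<noteq> {}" by (rule carrier_not_empty)
  show "\<rho> g *v v \<in> sphere 0 1" if "g \<in> carrier G" for g
    using that v by (simp add: norm_rho)
  fix f :: "complex ^ 'n \<Rightarrow> complex" assume "f \<in> H_sum \<tau>"
  then obtain F h where F: "f = (\<Sum>i\<in>F. h i)" "finite F" "F \<subseteq> \<tau>"
    and "\<forall>(p, q)\<in>F. h (p, q) \<in> H p q"
    unfolding H_sum_def by blast
  then have h: "h (p, q) \<in> H p q" if "(p, q) \<in> F" for p q
    using that by auto
  have int: "integrable sphere_measure (h i)" if "i \<in> F" for i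
    using that h[of "fst i" "snd i"] by (simp add: integrable_H)
  have "(\<Sum>g\<in>carrier G. f (\<rho> g *v v)) / of_nat (card (carrier G))
      = (\<Sum>i\<in>F. (\<Sum>g\<in>carrier G. h i (\<rho> g *v v)) / of_nat (card (carrier G)))"
    unfolding F(1) sum_fun_apply by (subst sum.swap) (simp add: sum_divide_distrib)
  also have "\<dots> = (\<Sum>i\<in>F. LINT v|sphere_measure. h i v)"
  proof (intro sum.cong refl)
    fix i assume i: "i \<in> F"
    show "(\<Sum>g\<in>carrier G. h i (\<rho> g *v v)) / of_nat (card (carrier G)) = (LINT v|sphere_measure. h i v)"
      using i h[of "fst i" "snd i"] F(3) assms
      by (intro orbit_average_eq_integral[of _ "fst i" "snd i"]) auto
  qed
  also have "\<dots> = (LINT v|sphere_measure. f v)"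
    unfolding F(1) sum_fun_apply using int by (simp add: Bochner_Integration.integral_sum)
  finally show "(\<Sum>g\<in>carrier G. f (\<rho> g *v v)) / of_nat (card (carrier G)) = (LINT v|sphere_measure. f v)" .
qed

text \<open>For an invariant \<open>f\<close> the orbit average at \<open>v\<close> is
  \<open>f v\<close> itself, while the design property equates it with the integral, which is 0
  outside bidegree \<open>(0, 0)\<close>. Letting \<open>v\<close> run over the sphere gives
  \<open>f = 0\<close>.\<close>

lemma subset_tau_G_of_spherical_design:
  assumes design: "\<And>v. v \<in> sphere 0 1 \<Longrightarrow> spherical_design \<tau> (carrier G) (\<lambda>g. \<rho> g *v v)"
  shows "\<tau> \<subseteq> tau_G G \<rho>"
proof clarify
  fix p q assume pq: "(p, q) \<in> \<tau>"
  have "f = 0" if f: "f \<in> H_inv G \<rho> p q" and "(p, q) \<noteq> (0, 0)" for f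
  proof
    fix v
    have fH: "f \<in> H p q" using f by (simp add: H_inv_def)
    show "f v = 0 v"
    proof (cases "v \<in> sphere 0 1")
      case True
      have "f \<in> H_sum \<tau>"
        unfolding H_sum_def using pq fH
        by (intro CollectI exI[of _ "{(p, q)}"] exI[of _ "\<lambda>_. f"]) auto
      then have "(\<Sum>g\<in>carrier G. f (\<rho> g *v v)) / of_nat (card (carrier G)) = (LINT v|sphere_measure. f v)"
        using design[OF True] unfolding spherical_design_def by blast
      also have "\<dots> = 0" using fH that(2) by (rule integral_H_eq_zero)
      finally show ?thesis
        using fin carrier_not_empty by (simp add: H_inv_orbit_sum[OF f])
    \<comment> \<open>Off the sphere, elements of \<open>H p q\<close> are zero by the convention of
      \<open>on_sphere\<close>.\<close>
    next
      case False
      then show ?thesis using fH by (auto simp: H_def on_sphere_def)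
    qed
  qed
  then show "(p, q) \<in> tau_G G \<rho>"
    using zero_in_H_inv[of G \<rho> p q] by (cases "(p, q) = (0, 0)") (auto simp: tau_G_def)
qed

end

theorem mainTheorem2:
  fixes G :: "('g, 'm) monoid_scheme"
    and \<rho> :: "'g \<Rightarrow> complex ^ 'n ^ 'n"
    and \<tau> :: "(nat \<times> nat) set"
  assumes "group G" and "finite (carrier G)"
    and "\<rho> \<in> hom G unitary_group"
  shows "((\<forall>v\<in>sphere 0 1. spherical_design \<tau> (carrier G) (\<lambda>g. \<rho> g *v v))
            \<longleftrightarrow> \<tau> \<subseteq> tau_G G \<rho>)
       \<and> (\<tau> \<subseteq> tau_G G \<rho>
            \<longleftrightarrow> (\<forall>(p, q)\<in>\<tau>. (p, q) \<noteq> (0, 0) \<longrightarrow> cfun.dim (H_inv G \<rho> p q) = 0))"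
proof
  show "(\<forall>v\<in>sphere 0 1. spherical_design \<tau> (carrier G) (\<lambda>g. \<rho> g *v v)) \<longleftrightarrow> \<tau> \<subseteq> tau_G G \<rho>"
    using spherical_design_orbit_of_subset[OF assms] subset_tau_G_of_spherical_design[OF assms]
    by blast
  show "\<tau> \<subseteq> tau_G G \<rho>
      \<longleftrightarrow> (\<forall>(p, q)\<in>\<tau>. (p, q) \<noteq> (0, 0) \<longrightarrow> cfun.dim (H_inv G \<rho> p q) = 0)"
    unfolding dim_H_inv_eq_0_iff tau_G_def by auto
qed

end
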